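(* Let $\mathrm{Y}(\mathfrak{q}_1)$ be the Yangian of the queer Lie superalgebra $\mathfrak{q}_1$. Let $C(u)=t_{1,1}(u)\tilde t_{1,1}(-u)$ and $D(u)=t_{1,-1}(u)\tilde t_{1,-1}(u)$, let $Q(u)=(1+H(u))(1-H(u))^{-1}$ with $H(u)=\sum_{i\ge 0}Z_{2i}u^{-2i-1}$, and let $\delta(u)=\sqrt{1+4u^2}$ and $\rho(u)=\frac{\delta(u)-1}{2}$ (all as defined in the context). Then the following relations hold in $\mathrm{Y}(\mathfrak{q}_1)[[u^{-1}]]$: $$C(u)=\frac{\delta(u)-2u}{2\delta(u)}\,Q(\rho(u))+\frac{\delta(u)+2u}{2\delta(u)}\,[Q(\rho(u)+1)]^{-1},$$ $$D(u)=\frac{[Q(\rho(u)+1)]^{-1}-Q(\rho(u))}{2\delta(u)}.$$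
   Context: All algebras are over $\mathbb{C}$. Indices $i,j,k,l$ run over $\{1,-1\}$; $\bar i=0$ if $i>0$ and $\bar i=1$ if $i<0$. The Yangian $\mathrm{Y}(\mathfrak{q}_1)$ is the unital associative superalgebra with generators $t_{i,j}^{(r)}$ ($r=1,2,\dots$; $i,j=\pm1$) of $\mathbb{Z}_2$-degree $\bar i+\bar j$. With $t_{i,j}(u)=\delta_{i,j}+t_{i,j}^{(1)}u^{-1}+t_{i,j}^{(2)}u^{-2}+\cdots$, the defining relations are $$[t_{i,j}(u),t_{k,l}(v)](-1)^{\bar i\bar k+\bar i\bar l+\bar k\bar l}=\frac{t_{k,j}(u)t_{i,l}(v)-t_{k,j}(v)t_{i,l}(u)}{u-v}-\frac{t_{-k,j}(u)t_{-i,l}(v)-t_{k,-j}(v)t_{i,-l}(u)}{u+v}(-1)^{\bar k+\bar l}$$ and $t_{i,j}(-u)=t_{-i,-j}(u)$, where $[\cdot,\cdot]$ is the supercommutator. Let $E_{i,j}\in\mathrm{End}\,\mathbb{C}^{1|1}$ be the matrix units, of degree $\bar i+\bar j$. The element $T(u)=\sum_{i,j}E_{i,j}\otimes t_{i,j}(u)$ of the super tensor product $\mathrm{End}\,\mathbb{C}^{1|1}\otimes\mathrm{Y}(\mathfrak{q}_1)[[u^{-1}]]$ is invertible (multiplication $(a\otimes b)(c\otimes d)=(-1)^{\deg b\deg c}ac\otimes bd$), and $\tilde t_{i,j}(u)$ is defined by $T(u)^{-1}=\sum_{i,j}E_{i,j}\otimes\tilde t_{i,j}(u)$. For $i\ge0$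 put $\eta_i=(-\tfrac12)^i(\mathrm{ad}\,t_{1,1}^{(2)})^i(t_{1,-1}^{(1)})$ and $Z_{2i}=\tfrac12[\eta_0,\eta_{2i}]$ (supercommutator). The elements $Z_{2i}$ and all coefficients of $C(u)$ are known to be central in $\mathrm{Y}(\mathfrak{q}_1)$. The series $\delta(u)$ is the formal Laurent series in $u^{-1}$ $$\delta(u)=2u\sqrt{1+\tfrac{1}{4u^2}}=2u\left(1+\tfrac18u^{-2}-\tfrac1{128}u^{-4}+\cdots\right),$$ so that $\delta(u)^2=1+4u^2$, and $\frac1{\delta(u)}$ is its inverse, a power series in $u^{-1}$ with leading term $\tfrac12u^{-1}$. Since $\rho(u)=u-\tfrac12+\cdots$, the series $Q(\rho(u))$ and $Q(\rho(u)+1)$ are obtained by substituting $\rho(u)$, respectively $\rho(u)+1$, for $u$ in $Q(u)$ and expanding in powers of $u^{-1}$. *)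

theory Defs
  imports
    "HOL-Computational_Algebra.Formal_Laurent_Series"
    "HOL-Library.Poly_Mapping"
begin

section \<open>The index set\<close>

datatype idx = Pos | Neg

text \<open>The two indices are written \<open>1\<close> and \<open>- 1\<close>.\<close>

instantiation idx :: "{one, uminus}"
begin
definition one_idx_def: "1 = Pos"
definition uminus_idx_def: "- i = (case i of Pos \<Rightarrow> Neg | Neg \<Rightarrow> Pos)"
instance ..
end

definition bar :: "idx \<Rightarrow> nat" where
  "bar i = (if i = 1 then 0 else 1)"

lemma idx_neq [simp]: "(1::idx) \<noteq> - 1" "- 1 \<noteq> (1::idx)"
  by (simp_all add: one_idx_def uminus_idx_def)

lemma idx_minus_minus [simp]: "- (- i) = (i::idx)"
  by (cases i) (simp_all add: uminus_idx_def)

lemma idx_exhaust: "(i::idx) = 1 \<or> i = - 1"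
  by (cases i) (simp_all add: one_idx_def uminus_idx_def)

lemma bar_1 [simp]: "bar 1 = 0" and bar_neg1 [simp]: "bar (- 1) = 1"
  by (simp_all add: bar_def)


section \<open>The free superalgebra\<close>

text \<open>\<open>Gen i j r\<close> stands for the generator \<open>t\<^sub>i\<^sub>j\<close> with upper index \<open>r + 1\<close>.\<close>

datatype gen = Gen idx idx nat

text \<open>Words form a monoid under concatenation, written additively as \<^theory>\<open>HOL-Library.Poly_Mapping\<close>
  requires; its convolution product then makes \<open>falg\<close> the free associative unital algebra.\<close>

instantiation list :: (type) monoid_add
begin
definition zero_list_def: "0 = []"
definition plus_list_def: "xs + ys = xs @ ys"
instance by standard (simp_all add: zero_list_def plus_list_def)
end

type_synonym falg = "gen list \<Rightarrow>\<^sub>0 complex"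

fun gen_deg :: "gen \<Rightarrow> nat" where
  "gen_deg (Gen i j r) = bar i + bar j"

definition word_deg :: "gen list \<Rightarrow> nat" where
  "word_deg w = sum_list (map gen_deg w)"

text \<open>The parity automorphism, acting on homogeneous \<open>a\<close> as multiplication by \<open>(-1)\<close> to the degree
  of \<open>a\<close>.\<close>

definition parF :: "falg \<Rightarrow> falg" where
  "parF = Poly_Mapping.mapp (\<lambda>w c. (- 1) ^ word_deg w * c)"

lemma lookup_parF: "Poly_Mapping.lookup (parF p) w = (- 1) ^ word_deg w * Poly_Mapping.lookup p w"
  by (auto simp: parF_def lookup_mapp when_def in_keys_iff)

lemma word_deg_plus: "word_deg (v + w) = word_deg v + word_deg w"
  by (simp add: word_deg_def plus_list_def)

lemma word_deg_0: "word_deg 0 = 0" "word_deg [] = 0"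
  by (simp_all add: word_deg_def zero_list_def)

lemma parF_add: "parF (p + q) = parF p + parF q"
  by (rule poly_mapping_eqI) (simp add: lookup_parF lookup_add algebra_simps)

lemma parF_diff: "parF (p - q) = parF p - parF q"
  by (rule poly_mapping_eqI) (simp add: lookup_parF lookup_minus algebra_simps)

lemma parF_uminus: "parF (- p) = - parF p"
  by (rule poly_mapping_eqI) (simp add: lookup_parF)

lemma parF_0: "parF 0 = 0"
  by (rule poly_mapping_eqI) (simp add: lookup_parF)

lemma parF_single: "parF (Poly_Mapping.single w c) = Poly_Mapping.single w ((- 1) ^ word_deg w * c)"
  by (rule poly_mapping_eqI) (auto simp add: lookup_parF lookup_single when_def)

lemma parF_1: "parF 1 = 1"
  by (metis parF_single mult_1 power_0 single_one word_deg_0(1))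

lemma parF_parF: "parF (parF p) = p"
  by (rule poly_mapping_eqI) (simp add: lookup_parF flip: mult.assoc power_add mult_2)

lemma parF_mult: "parF (p * q) = parF p * parF q"
proof (rule poly_mapping_eqI)
  fix k
  let ?s = "\<lambda>w. (- 1) ^ word_deg w :: complex"
  let ?f = "Poly_Mapping.lookup p" and ?g = "Poly_Mapping.lookup q"
  let ?h = "\<lambda>l. Sum_any (\<lambda>q. ?g q when k = l + q)"
  have fin: "finite {l. ?f l * ?h l \<noteq> 0}"
    by (rule finite_subset[of _ "{l. ?f l \<noteq> 0}"]) auto
  have fing: "finite {q. (?g q when k = l + q) \<noteq> 0}" for l
    by (rule finite_subset[of _ "{q. ?g q \<noteq> 0}"]) auto
  have "Poly_Mapping.lookup (parF (p * q)) k = ?s k * Sum_any (\<lambda>l. ?f l * ?h l)"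
    by (simp add: lookup_parF lookup_mult)
  also have "\<dots> = Sum_any (\<lambda>l. ?s k * (?f l * ?h l))"
    by (rule Sum_any_right_distrib[OF fin])
  also have "\<dots> = Sum_any (\<lambda>l. ?s l * ?f l * Sum_any (\<lambda>q. ?s q * ?g q when k = l + q))"
  proof (rule Sum_any.cong)
    fix l
    have "?s k * ?h l = Sum_any (\<lambda>q. ?s k * (?g q when k = l + q))"
      by (rule Sum_any_right_distrib[OF fing])
    also have "\<dots> = Sum_any (\<lambda>q. ?s l * (?s q * ?g q when k = l + q))"
      by (rule Sum_any.cong) (auto simp: when_def word_deg_plus power_add)
    also have "\<dots> = ?s l * Sum_any (\<lambda>q. ?s q * ?g q when k = l + q)"
      by (rule Sum_any_right_distrib[symmetric], rule finite_subset[of _ "{q. ?g q \<noteq> 0}"]) auto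
    finally show "?s k * (?f l * ?h l) =
        ?s l * ?f l * Sum_any (\<lambda>q. ?s q * ?g q when k = l + q)"
      by (simp add: algebra_simps)
  qed
  also have "\<dots> = Poly_Mapping.lookup (parF p * parF q) k"
    by (simp add: lookup_parF lookup_mult)
  finally show "Poly_Mapping.lookup (parF (p * q)) k = Poly_Mapping.lookup (parF p * parF q) k" .
qed


section \<open>The defining relations\<close>

definition tF :: "idx \<Rightarrow> idx \<Rightarrow> nat \<Rightarrow> falg" where
  "tF i j r = (case r of 0 \<Rightarrow> (if i = j then 1 else 0) | Suc s \<Rightarrow> Poly_Mapping.single [Gen i j s] 1)"

text \<open>Power series in \<open>x = 1/u\<close> and \<open>y = 1/v\<close> are elements of \<open>falg fps fps\<close>, with \<open>x\<close> the outer
  and \<open>y\<close> the inner variable.\<close>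

definition tu :: "idx \<Rightarrow> idx \<Rightarrow> falg fps fps" where
  "tu i j = Abs_fps (\<lambda>r. fps_const (tF i j r))"

definition tv :: "idx \<Rightarrow> idx \<Rightarrow> falg fps fps" where
  "tv i j = fps_const (Abs_fps (tF i j))"

abbreviation xvar :: "falg fps fps" where "xvar \<equiv> fps_X"
abbreviation yvar :: "falg fps fps" where "yvar \<equiv> fps_const fps_X"

definition supercomm_uv :: "idx \<Rightarrow> idx \<Rightarrow> idx \<Rightarrow> idx \<Rightarrow> falg fps fps" where
  "supercomm_uv i j k l =
     tu i j * tv k l - (- 1) ^ ((bar i + bar j) * (bar k + bar l)) * (tv k l * tu i j)"

text \<open>The difference of the two sides of the quadratic relation, multiplied by
  \<open>x\<^sup>2y\<^sup>2(u\<^sup>2 - v\<^sup>2) = y\<^sup>2 - x\<^sup>2\<close> to clear denominators; note that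
  \<open>x\<^sup>2y\<^sup>2(u + v) = xy(x + y)\<close> and \<open>x\<^sup>2y\<^sup>2(u - v) = xy(y - x)\<close>. Multiplication by \<open>y\<^sup>2 - x\<^sup>2\<close> is injective
  on power series over any algebra, so no information is lost.\<close>

definition quad_rel :: "idx \<Rightarrow> idx \<Rightarrow> idx \<Rightarrow> idx \<Rightarrow> falg fps fps" where
  "quad_rel i j k l =
     (yvar ^ 2 - xvar ^ 2) *
       ((- 1) ^ (bar i * bar k + bar i * bar l + bar k * bar l) * supercomm_uv i j k l)
     - (xvar * yvar * (xvar + yvar) * (tu k j * tv i l - tv k j * tu i l)
        - xvar * yvar * (yvar - xvar) *
            ((- 1) ^ (bar k + bar l) * (tu (- k) j * tv (- i) l - tv k (- j) * tu i (- l))))"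

definition relators :: "falg set" where
  "relators =
     {quad_rel i j k l $ r $ s | i j k l r s. True} \<union>
     {(- 1) ^ r * tF i j r - tF (- i) (- j) r | i j r. True}"

text \<open>The two-sided ideal generated by the relators. Since the scalars lie in \<open>falg\<close>, it is
  automatically a complex subspace.\<close>

inductive_set yideal :: "falg set" where
  zero: "0 \<in> yideal"
| add: "p \<in> yideal \<Longrightarrow> q \<in> relators \<Longrightarrow> p + a * q * b \<in> yideal"

lemma yideal_add: "q \<in> yideal \<Longrightarrow> p \<in> yideal \<Longrightarrow> p + q \<in> yideal"
  by (induction rule: yideal.induct) (auto simp flip: add.assoc intro: yideal.intros)

lemma yideal_mult_left: "p \<in> yideal \<Longrightarrow> c * p \<in> yideal"
proof (induction rule: yideal.induct)
  case (add p q a b)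
  then show ?case using yideal.add[of "c * p" q "c * a" b] by (simp add: algebra_simps)
qed (simp add: yideal.zero)

lemma yideal_mult_right: "p \<in> yideal \<Longrightarrow> p * c \<in> yideal"
proof (induction rule: yideal.induct)
  case (add p q a b)
  then show ?case using yideal.add[of "p * c" q a "b * c"] by (simp add: algebra_simps)
qed (simp add: yideal.zero)

lemma yideal_uminus: "p \<in> yideal \<Longrightarrow> - p \<in> yideal"
  using yideal_mult_left[of p "- 1"] by simp

lemma yideal_diff: "p \<in> yideal \<Longrightarrow> q \<in> yideal \<Longrightarrow> p - q \<in> yideal"
  using yideal_add[of "- q" p] yideal_uminus[of q] by simp

subsection \<open>The ideal is proper and homogeneous\<close>

text \<open>Both facts are obtained from ring endomorphisms of \<open>falg\<close> applied coefficientwise to the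
  relators: the counit (which keeps only the constant term) and the parity automorphism.\<close>

definition counit :: "falg \<Rightarrow> falg" where
  "counit p = Poly_Mapping.single 0 (Poly_Mapping.lookup p 0)"

lemma counit_add: "counit (p + q) = counit p + counit q"
  by (simp add: counit_def lookup_add single_add)

lemma lookup_mult_0:
  fixes p q :: falg
  shows "Poly_Mapping.lookup (p * q) 0 = Poly_Mapping.lookup p 0 * Poly_Mapping.lookup q 0"
proof -
  have "Poly_Mapping.lookup (p * q) 0 =
      Sum_any (\<lambda>l. Poly_Mapping.lookup p l *
        Sum_any (\<lambda>w. Poly_Mapping.lookup q w when 0 = l + w))"
    by (simp add: lookup_mult)
  also have "\<dots> = Sum_any (\<lambda>l::gen list. (Poly_Mapping.lookup p 0 * Poly_Mapping.lookup q 0) when l = 0)"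
  proof (rule Sum_any.cong)
    fix l :: "gen list"
    have "Sum_any (\<lambda>w. Poly_Mapping.lookup q w when 0 = l + w) =
        Sum_any (\<lambda>w::gen list. (Poly_Mapping.lookup q 0 when l = 0) when w = 0)"
      by (rule Sum_any.cong) (auto simp: when_def zero_list_def plus_list_def)
    then show "Poly_Mapping.lookup p l * Sum_any (\<lambda>w. Poly_Mapping.lookup q w when 0 = l + w) =
        ((Poly_Mapping.lookup p 0 * Poly_Mapping.lookup q 0) when l = 0)"
      by (simp add: when_def)
  qed
  finally show ?thesis by simp
qed

lemma counit_mult: "counit (p * q) = counit p * counit q"
  by (simp add: counit_def lookup_mult_0 mult_single)

lemma counit_tF: "counit (tF i j r) = (if i = j \<and> r = 0 then 1 else 0)"
  by (cases r) (auto simp: counit_def tF_def lookup_single when_def zero_list_def simp flip: single_one)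

lemma parF_tF: "parF (tF i j r) = (- 1) ^ (bar i + bar j) * tF i j r"
proof (cases r)
  case 0
  then show ?thesis by (auto simp: tF_def parF_1 parF_0 simp flip: mult_2)
next
  case (Suc s)
  have "(- 1) ^ n * Poly_Mapping.single w 1 = Poly_Mapping.single w ((- 1) ^ n :: complex)"
    for n and w :: "gen list"
    by (cases "even n") (simp_all add: single_uminus)
  with Suc show ?thesis by (simp add: tF_def parF_single word_deg_def)
qed

definition map_uv :: "(falg \<Rightarrow> falg) \<Rightarrow> falg fps fps \<Rightarrow> falg fps fps" where
  "map_uv h F = Abs_fps (\<lambda>r. Abs_fps (\<lambda>s. h (F $ r $ s)))"

lemma map_uv_nth [simp]: "map_uv h F $ r $ s = h (F $ r $ s)"
  by (simp add: map_uv_def)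

lemma fps_fps_eqI: "(\<And>r s. F $ r $ s = G $ r $ s) \<Longrightarrow> F = G"
  by (intro fps_ext) simp

context
  fixes h :: "falg \<Rightarrow> falg"
  assumes h_add: "\<And>p q. h (p + q) = h p + h q"
    and h_mult: "\<And>p q. h (p * q) = h p * h q"
    and h_1: "h 1 = 1"
begin

lemma h_0: "h 0 = 0"
  using h_add[of 0 0] by simp

lemma h_uminus: "h (- p) = - h p"
  using h_add[of p "- p"] h_0 by (simp add: add_eq_0_iff)

lemma h_sum: "h (sum f A) = (\<Sum>x\<in>A. h (f x))"
  by (induction A rule: infinite_finite_induct) (simp_all add: h_0 h_add)

lemma map_uv_add: "map_uv h (F + G) = map_uv h F + map_uv h G"
  by (rule fps_fps_eqI) (simp add: h_add)

lemma map_uv_uminus: "map_uv h (- F) = - map_uv h F"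
  by (rule fps_fps_eqI) (simp add: h_uminus)

lemma map_uv_diff: "map_uv h (F - G) = map_uv h F - map_uv h G"
  using map_uv_add[of F "- G"] map_uv_uminus[of G] by simp

lemma map_uv_mult: "map_uv h (F * G) = map_uv h F * map_uv h G"
  by (rule fps_fps_eqI) (simp add: fps_mult_nth fps_sum_nth h_sum h_mult)

lemma map_uv_1: "map_uv h 1 = 1"
  by (rule fps_fps_eqI) (simp add: h_0 h_1)

lemma map_uv_power: "map_uv h (F ^ n) = map_uv h F ^ n"
  by (induction n) (simp_all add: map_uv_1 map_uv_mult)

lemma map_uv_xvar: "map_uv h xvar = xvar"
  by (rule fps_fps_eqI) (simp add: fps_X_def h_0 h_1)

lemma map_uv_yvar: "map_uv h yvar = yvar"
  by (rule fps_fps_eqI) (simp add: fps_X_def h_0 h_1)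

lemmas map_uv_simps = map_uv_add map_uv_uminus map_uv_diff map_uv_mult map_uv_1 map_uv_power
  map_uv_xvar map_uv_yvar

end

lemma counit_1: "counit 1 = 1"
  using counit_tF[of 1 1 0] by (simp add: tF_def)

lemma counit_tu: "map_uv counit (tu i j) = (if i = j then 1 else 0)"
  by (rule fps_fps_eqI) (auto simp: tu_def counit_tF counit_def[of 0])

lemma counit_tv: "map_uv counit (tv i j) = (if i = j then 1 else 0)"
  by (rule fps_fps_eqI) (auto simp: tv_def counit_tF counit_def[of 0])

lemma parF_tu: "map_uv parF (tu i j) = (- 1) ^ (bar i + bar j) * tu i j"
  by (cases "even (bar i + bar j)"; intro fps_fps_eqI) (auto simp: tu_def parF_tF parF_0)

lemma parF_tv: "map_uv parF (tv i j) = (- 1) ^ (bar i + bar j) * tv i j"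
  by (cases "even (bar i + bar j)"; intro fps_fps_eqI) (auto simp: tv_def parF_tF parF_0)

lemma idx_minus_eq_iff: "- i = j \<longleftrightarrow> i = - (j::idx)"
  by (metis idx_minus_minus)

lemma map_uv_sign:
  assumes "\<And>p q. h (p + q) = h p + h q" "\<And>p q. h (p * q) = h p * h q" "h 1 = 1"
  shows "map_uv h ((- 1) ^ n) = (- 1) ^ n"
  by (simp only: map_uv_power[OF assms] map_uv_uminus[OF assms] map_uv_1[OF assms])

lemma counit_quad_rel: "map_uv counit (quad_rel i j k l) = 0"
proof -
  note hom = counit_add counit_mult counit_1
  have supercomm: "map_uv counit (supercomm_uv i j k l) = 0"
    unfolding supercomm_uv_def map_uv_mult[OF hom] map_uv_diff[OF hom] map_uv_sign[OF hom]
      counit_tu counit_tv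
    by (auto simp flip: mult_2)
  have first: "map_uv counit (tu k j * tv i l - tv k j * tu i l) = 0"
    unfolding map_uv_mult[OF hom] map_uv_diff[OF hom] counit_tu counit_tv by simp
  have second: "map_uv counit (tu (- k) j * tv (- i) l - tv k (- j) * tu i (- l)) = 0"
    unfolding map_uv_mult[OF hom] map_uv_diff[OF hom] counit_tu counit_tv idx_minus_eq_iff
    by simp
  have "map_uv counit (A * (c * x1) - (B * x2 - C * (c' * x3))) =
      map_uv counit A * (map_uv counit c * map_uv counit x1)
      - (map_uv counit B * map_uv counit x2 - map_uv counit C * (map_uv counit c' * map_uv counit x3))"
    for A B C c c' x1 x2 x3
    by (simp only: map_uv_diff[OF hom] map_uv_mult[OF hom])
  then show ?thesis
    unfolding quad_rel_def by (simp only: supercomm first second mult_zero_right diff_zero)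
qed

lemma neg_one_power_mult:
  "((- 1) ^ m * A) * ((- 1) ^ n * B) = (- 1) ^ (m + n) * (A * B)" for A B :: "'c::ring_1"
  by (cases "even m"; cases "even n") simp_all

lemma parF_tu_tv:
  assumes "s = (- 1) ^ (bar i + bar j + bar k + bar l)"
  shows "map_uv parF (tu i j * tv k l) = s * (tu i j * tv k l)"
    and "map_uv parF (tv i j * tu k l) = s * (tv i j * tu k l)"
  unfolding assms map_uv_mult[OF parF_add parF_mult parF_1] parF_tu parF_tv neg_one_power_mult
  by (simp_all only: add.assoc)

lemma sign_factor:
  fixes s :: "'c::ring_1"
  assumes "s = 1 \<or> s = - 1"
  shows "A * (c * (s * x1 - c' * (s * x2))) - (B * (s * x3 - s * x4) - C * (c'' * (s * x5 - s * x6)))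
    = s * (A * (c * (x1 - c' * x2)) - (B * (x3 - x4) - C * (c'' * (x5 - x6))))"
  using assms
proof
  assume "s = - 1"
  then show ?thesis by (simp only: mult_minus1 mult_minus_right minus_diff_eq
    diff_minus_eq_add minus_add_distrib minus_minus) (simp add: algebra_simps)
qed simp

lemma parF_quad_rel:
  "map_uv parF (quad_rel i j k l) = (- 1) ^ (bar i + bar j + bar k + bar l) * quad_rel i j k l"
proof -
  note hom = parF_add parF_mult parF_1
  define s :: "falg fps fps" where "s = (- 1) ^ (bar i + bar j + bar k + bar l)"
  have s: "s = 1 \<or> s = - 1"
    unfolding s_def by (cases "even (bar i + bar j + bar k + bar l)") simp_all
  have m: "map_uv parF (tu i j * tv k l) = s * (tu i j * tv k l)"
    "map_uv parF (tv k l * tu i j) = s * (tv k l * tu i j)"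
    "map_uv parF (tu k j * tv i l) = s * (tu k j * tv i l)"
    "map_uv parF (tv k j * tu i l) = s * (tv k j * tu i l)"
    by (rule parF_tu_tv, simp add: s_def add_ac)+
  have "s = (- 1) ^ (bar (- k) + bar j + bar (- i) + bar l)"
    using idx_exhaust[of i] idx_exhaust[of k] unfolding s_def by (elim disjE) simp_all
  then have m5: "map_uv parF (tu (- k) j * tv (- i) l) = s * (tu (- k) j * tv (- i) l)"
    by (rule parF_tu_tv)
  have "s = (- 1) ^ (bar k + bar (- j) + bar i + bar (- l))"
    using idx_exhaust[of j] idx_exhaust[of l] unfolding s_def by (elim disjE) (simp_all add: add_ac)
  then have m6: "map_uv parF (tv k (- j) * tu i (- l)) = s * (tv k (- j) * tu i (- l))"
    by (rule parF_tu_tv)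
  have fixed: "map_uv parF (yvar ^ 2 - xvar ^ 2) = yvar ^ 2 - xvar ^ 2"
    "map_uv parF (xvar * yvar * (xvar + yvar)) = xvar * yvar * (xvar + yvar)"
    "map_uv parF (xvar * yvar * (yvar - xvar)) = xvar * yvar * (yvar - xvar)"
    by (simp_all only: map_uv_simps[of parF, OF hom])
  have "map_uv parF (A * (c * (x1 - c' * x2)) - (B * (x3 - x4) - C * (c'' * (x5 - x6)))) =
      map_uv parF A * (map_uv parF c * (map_uv parF x1 - map_uv parF c' * map_uv parF x2))
      - (map_uv parF B * (map_uv parF x3 - map_uv parF x4)
         - map_uv parF C * (map_uv parF c'' * (map_uv parF x5 - map_uv parF x6)))"
    for A B C c c' c'' x1 x2 x3 x4 x5 x6
    by (simp only: map_uv_diff[OF hom] map_uv_mult[OF hom])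
  then show ?thesis
    unfolding quad_rel_def supercomm_uv_def s_def[symmetric]
    by (simp only: fixed m m5 m6 map_uv_sign[OF hom] sign_factor[OF s])
qed

lemma minus_one_power_fps_nth: "((- 1) ^ n * F) $ r = (- 1) ^ n * (F $ r)"
  for F :: "'c::ring_1 fps"
  by (cases "even n") simp_all

lemma counit_relators:
  assumes "q \<in> relators" shows "counit q = 0"
proof -
  consider i j k l r s where "q = quad_rel i j k l $ r $ s"
    | i j r where "q = (- 1) ^ r * tF i j r - tF (- i) (- j) r"
    using assms by (auto simp: relators_def)
  then show ?thesis
  proof cases
    case 1
    then have "counit q = map_uv counit (quad_rel i j k l) $ r $ s"
      by simp
    then show ?thesis by (simp only: counit_quad_rel fps_zero_nth)
  next
    case (2 i j r)
    then show ?thesis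
      using h_uminus[OF counit_add counit_mult counit_1] counit_add[of "(- 1) ^ r * tF i j r" "- tF (- i) (- j) r"]
      by (cases "even r"; cases "r = 0") (auto simp: counit_mult counit_tF idx_minus_eq_iff)
  qed
qed

lemma counit_yideal: "p \<in> yideal \<Longrightarrow> counit p = 0"
proof (induction rule: yideal.induct)
  case zero
  show ?case by (simp add: counit_def)
next
  case (add p q a b)
  then show ?case by (simp add: counit_add counit_mult counit_relators)
qed

lemma one_notin_yideal: "1 \<notin> yideal"
  using counit_yideal[of 1] counit_1 by auto

lemma minus_one_power_relators:
  assumes "p \<in> yideal" "q \<in> relators" shows "p + a * ((- 1) ^ n * q) * b \<in> yideal"
  using yideal.add[OF assms, of "(- 1) ^ n * a" b] by (cases "even n") simp_all

lemma parF_relators: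
  assumes "q \<in> relators" shows "\<exists>n. parF q = (- 1) ^ n * q"
proof -
  consider i j k l r s where "q = quad_rel i j k l $ r $ s"
    | i j r where "q = (- 1) ^ r * tF i j r - tF (- i) (- j) r"
    using assms by (auto simp: relators_def)
  then show ?thesis
  proof cases
    case 1
    then have "parF q = map_uv parF (quad_rel i j k l) $ r $ s"
      by simp
    also have "\<dots> = (- 1) ^ (bar i + bar j + bar k + bar l) * q"
      by (simp only: parF_quad_rel minus_one_power_fps_nth 1)
    finally show ?thesis ..
  next
    case (2 i j r)
    have "parF (tF (- i) (- j) r) = (- 1) ^ (bar i + bar j) * tF (- i) (- j) r"
      using idx_exhaust[of i] idx_exhaust[of j] by (elim disjE) (simp_all add: parF_tF)
    with 2 have "parF q = (- 1) ^ (bar i + bar j) * q"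
      by (cases "even r"; cases "even (bar i + bar j)")
        (simp_all add: parF_diff parF_uminus parF_tF)
    then show ?thesis ..
  qed
qed

lemma parF_yideal: "p \<in> yideal \<Longrightarrow> parF p \<in> yideal"
proof (induction rule: yideal.induct)
  case zero
  show ?case by (simp add: parF_0 yideal.zero)
next
  case (add p q a b)
  then show ?case using parF_relators[of q] minus_one_power_relators[of "parF p" q]
    by (auto simp: parF_add parF_mult)
qed


section \<open>The Yangian\<close>

definition yrel :: "falg \<Rightarrow> falg \<Rightarrow> bool" where
  "yrel p q \<longleftrightarrow> p - q \<in> yideal"

lemma yrel_refl: "p = q \<Longrightarrow> yrel p q"
  by (simp add: yrel_def yideal.zero)

lemma yrel_equivp: "equivp yrel"
proof (rule equivpI)
  show "reflp yrel" by (rule reflpI) (simp add: yrel_refl)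
  show "symp yrel"
  proof (rule sympI)
    fix p q
    assume "yrel p q"
    then show "yrel q p" using yideal_uminus[of "p - q"] by (simp add: yrel_def)
  qed
  show "transp yrel"
  proof (rule transpI)
    fix p q r
    assume "yrel p q" "yrel q r"
    then show "yrel p r" using yideal_add[of "p - q" "q - r"] by (simp add: yrel_def)
  qed
qed

quotient_type yangian = falg / yrel
  by (rule yrel_equivp)

instantiation yangian :: ring_1
begin

lift_definition zero_yangian :: yangian is 0 .
lift_definition one_yangian :: yangian is 1 .

lift_definition plus_yangian :: "yangian \<Rightarrow> yangian \<Rightarrow> yangian" is "(+)"
proof -
  fix p p' q q'
  assume "yrel p p'" "yrel q q'"
  then have "(p - p') + (q - q') \<in> yideal"
    unfolding yrel_def by (intro yideal_add)
  then show "yrel (p + q) (p' + q')" by (simp add: yrel_def algebra_simps)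
qed

lift_definition minus_yangian :: "yangian \<Rightarrow> yangian \<Rightarrow> yangian" is "(-)"
proof -
  fix p p' q q'
  assume "yrel p p'" "yrel q q'"
  then have "(p - p') - (q - q') \<in> yideal"
    unfolding yrel_def by (rule yideal_diff)
  then show "yrel (p - q) (p' - q')" by (simp add: yrel_def algebra_simps)
qed

lift_definition uminus_yangian :: "yangian \<Rightarrow> yangian" is uminus
proof -
  fix p p'
  assume "yrel p p'"
  then have "- (p - p') \<in> yideal"
    unfolding yrel_def by (rule yideal_uminus)
  then show "yrel (- p) (- p')" by (simp add: yrel_def algebra_simps)
qed

lift_definition times_yangian :: "yangian \<Rightarrow> yangian \<Rightarrow> yangian" is "(*)"
proof -
  fix p p' q q'
  assume "yrel p p'" "yrel q q'"
  then have "(p - p') * q + p' * (q - q') \<in> yideal"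
    unfolding yrel_def by (intro yideal_add yideal_mult_left yideal_mult_right)
  then show "yrel (p * q) (p' * q')" by (simp add: yrel_def algebra_simps)
qed

instance
proof
  have "\<not> yrel 0 1"
    using one_notin_yideal yideal_uminus[of "- 1"] by (auto simp: yrel_def)
  then show "(0::yangian) \<noteq> 1"
    unfolding zero_yangian_def one_yangian_def by (simp add: yangian.abs_eq_iff)
qed (transfer, rule yrel_refl, simp add: algebra_simps)+

end

lift_definition tY :: "idx \<Rightarrow> idx \<Rightarrow> nat \<Rightarrow> yangian" is tF .

lift_definition scal :: "complex \<Rightarrow> yangian" is "Poly_Mapping.single []" .

lift_definition par :: "yangian \<Rightarrow> yangian" is parF
proof -
  fix p p'
  assume "yrel p p'"
  then show "yrel (parF p) (parF p')"
    using parF_yideal[of "p - p'"] by (simp add: yrel_def parF_diff)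
qed

lemma par_add: "par (a + b) = par a + par b"
  by transfer (simp add: parF_add yrel_refl)

lemma par_mult: "par (a * b) = par a * par b"
  by transfer (simp add: parF_mult yrel_refl)

lemma par_0 [simp]: "par 0 = 0"
  by transfer (simp add: parF_0 yrel_refl)

lemma par_1 [simp]: "par 1 = 1"
  by transfer (simp add: parF_1 yrel_refl)

lemma par_par [simp]: "par (par a) = a"
  by transfer (simp add: parF_parF yrel_refl)

lemma par_tY: "par (tY i j r) = (- 1) ^ (bar i + bar j) * tY i j r"
proof (cases "even (bar i + bar j)")
  case True
  then have "yrel (parF (tF i j r)) (tF i j r)"
    by (intro yrel_refl) (simp add: parF_tF)
  then have "par (tY i j r) = tY i j r"
    by transfer
  with True show ?thesis by simp
next
  case False
  then have "yrel (parF (tF i j r)) (- tF i j r)"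
    by (intro yrel_refl) (simp add: parF_tF)
  then have "par (tY i j r) = - tY i j r"
    by transfer
  with False show ?thesis by simp
qed

lemma scal_0 [simp]: "scal 0 = 0"
  by transfer (simp add: yrel_refl)

lemma scal_1 [simp]: "scal 1 = 1"
  by transfer (simp add: yrel_refl flip: zero_list_def)

lemma scal_add: "scal (a + b) = scal a + scal b"
  by transfer (simp add: yrel_refl single_add)

lemma scal_mult: "scal (a * b) = scal a * scal b"
  by transfer (simp add: yrel_refl mult_single plus_list_def)

definition even_part :: "yangian \<Rightarrow> yangian" where
  "even_part a = scal (1/2) * (a + par a)"

definition odd_part :: "yangian \<Rightarrow> yangian" where
  "odd_part a = scal (1/2) * (a - par a)"

text \<open>The bilinear extension of \<open>[a, b] = ab - (-1)\<^bsup>deg a deg b\<^esup> ba\<close>.\<close>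

definition supercomm :: "yangian \<Rightarrow> yangian \<Rightarrow> yangian" where
  "supercomm a b = a * b - (b * even_part a + par b * odd_part a)"

text \<open>\<open>scal c\<close> is central and even, so \<open>scal c * a\<close> is scalar multiplication.\<close>

lemma scal_central: "scal c * a = a * scal c"
proof -
  have "Poly_Mapping.single [] c * p = p * Poly_Mapping.single [] c" for p :: falg
  proof (rule poly_mapping_eqI)
    fix w
    have left: "Poly_Mapping.lookup (Poly_Mapping.single [] c * p) w = c * Poly_Mapping.lookup p w"
    proof -
      have "Poly_Mapping.lookup (Poly_Mapping.single [] c * p) w =
          Sum_any (\<lambda>l. (c * Sum_any (\<lambda>v. Poly_Mapping.lookup p v when w = l + v)) when l = [])"
        unfolding lookup_mult
        by (rule Sum_any.cong) (auto simp: lookup_single when_def)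
      also have "\<dots> = c * Sum_any (\<lambda>v. Poly_Mapping.lookup p v when w = v)"
        by (simp add: plus_list_def)
      finally show ?thesis by simp
    qed
    have "Poly_Mapping.lookup (p * Poly_Mapping.single [] c) w =
        Sum_any (\<lambda>l. (Poly_Mapping.lookup p w * c) when l = w)"
      unfolding lookup_mult
    proof (rule Sum_any.cong)
      fix l
      have "Sum_any (\<lambda>v. Poly_Mapping.lookup (Poly_Mapping.single [] c) v when w = l + v) =
          Sum_any (\<lambda>v::gen list. (c when l = w) when v = [])"
        by (rule Sum_any.cong) (auto simp: lookup_single when_def plus_list_def)
      then show "Poly_Mapping.lookup p l *
          Sum_any (\<lambda>v. Poly_Mapping.lookup (Poly_Mapping.single [] c) v when w = l + v) =
          ((Poly_Mapping.lookup p w * c) when l = w)"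
        by (simp add: when_def)
    qed
    with left show "Poly_Mapping.lookup (Poly_Mapping.single [] c * p) w =
        Poly_Mapping.lookup (p * Poly_Mapping.single [] c) w"
      by (simp add: mult.commute)
  qed
  then show ?thesis by transfer (simp add: yrel_refl)
qed

lemma par_scal [simp]: "par (scal c) = scal c"
  by transfer (simp add: parF_single word_deg_0 yrel_refl)


section \<open>The super tensor product with \<open>End C\<^bsup>1|1\<^esup>\<close>\<close>

text \<open>\<open>Smat X\<close> represents the sum of all \<open>E i j \<otimes> X i j\<close>.\<close>

typedef smat = "UNIV :: (idx \<Rightarrow> idx \<Rightarrow> yangian) set"
  morphisms entry Smat ..

setup_lifting type_definition_smat

text \<open>If \<open>a\<close> is homogeneous then \<open>(E i j \<otimes> a)(E k l \<otimes> b)\<close> is zero unless \<open>j = k\<close>, and otherwise it is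
  \<open>E i l \<otimes> ab\<close> times \<open>(-1)\<close> to the power \<open>deg a (bar k + bar l)\<close>. The sign is produced by
  applying \<open>par\<close> to \<open>a\<close> as often as the degree of \<open>E k l\<close> indicates; see \<open>tensor_mult\<close> below.\<close>

definition par_pow :: "nat \<Rightarrow> yangian \<Rightarrow> yangian" where
  "par_pow n = par ^^ n"

lemma par_pow_add: "par_pow n (a + b) = par_pow n a + par_pow n b"
  by (induction n) (simp_all add: par_pow_def par_add)

lemma par_pow_mult: "par_pow n (a * b) = par_pow n a * par_pow n b"
  by (induction n) (simp_all add: par_pow_def par_mult)

lemma par_pow_0 [simp]: "par_pow n 0 = 0"
  by (induction n) (simp_all add: par_pow_def)

lemma par_pow_1 [simp]: "par_pow n 1 = 1"
  by (induction n) (simp_all add: par_pow_def)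

lemma par_pow_simps [simp]: "par_pow 0 a = a" "par_pow (Suc 0) a = par a"
    "par_pow (Suc (Suc 0)) a = a"
  by (simp_all add: par_pow_def)

instantiation smat :: ring_1
begin

lift_definition zero_smat :: smat is "\<lambda>i j. 0" .
lift_definition one_smat :: smat is "\<lambda>i j. if i = j then 1 else 0" .
lift_definition plus_smat :: "smat \<Rightarrow> smat \<Rightarrow> smat" is "\<lambda>X Y i j. X i j + Y i j" .
lift_definition minus_smat :: "smat \<Rightarrow> smat \<Rightarrow> smat" is "\<lambda>X Y i j. X i j - Y i j" .
lift_definition uminus_smat :: "smat \<Rightarrow> smat" is "\<lambda>X i j. - X i j" .
lift_definition times_smat :: "smat \<Rightarrow> smat \<Rightarrow> smat"
  is "\<lambda>X Y i l. \<Sum>j\<in>{1, - 1}. par_pow (bar j + bar l) (X i j) * Y j l" .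

instance
proof
  fix a b c :: smat
  show "a * b * c = a * (b * c)"
  proof (transfer, intro ext)
    fix X Y Z :: "idx \<Rightarrow> idx \<Rightarrow> yangian" and i l
    show "(\<Sum>k\<in>{1, - 1}. par_pow (bar k + bar l)
             (\<Sum>j\<in>{1, - 1}. par_pow (bar j + bar k) (X i j) * Y j k) * Z k l) =
          (\<Sum>j\<in>{1, - 1}. par_pow (bar j + bar l) (X i j) *
             (\<Sum>k\<in>{1, - 1}. par_pow (bar k + bar l) (Y j k) * Z k l))"
      using idx_exhaust[of l]
      by (elim disjE) (simp_all add: par_add par_mult algebra_simps)
  qed
  show "1 * a = a"
  proof (transfer, intro ext)
    fix X :: "idx \<Rightarrow> idx \<Rightarrow> yangian" and i l
    show "(\<Sum>j\<in>{1, - 1}. par_pow (bar j + bar l) (if i = j then 1 else 0) * X j l) = X i l"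
      using idx_exhaust[of i] by (elim disjE) simp_all
  qed
  show "a * 1 = a"
  proof (transfer, intro ext)
    fix X :: "idx \<Rightarrow> idx \<Rightarrow> yangian" and i l
    show "(\<Sum>j\<in>{1, - 1}. par_pow (bar j + bar l) (X i j) * (if j = l then 1 else 0)) = X i l"
      using idx_exhaust[of l] by (elim disjE) (simp_all flip: mult_2)
  qed
  show "(0::smat) \<noteq> 1"
    by transfer (auto simp: fun_eq_iff)
qed (transfer, simp add: par_pow_add par_add algebra_simps fun_eq_iff)+

end

definition tensor :: "idx \<Rightarrow> idx \<Rightarrow> yangian \<Rightarrow> smat" where
  "tensor i j a = Smat (\<lambda>i' j'. if i' = i \<and> j' = j then a else 0)"

lemma smat_eqI: "(\<And>i j. entry X i j = entry Y i j) \<Longrightarrow> X = Y"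
  by (simp add: entry_inject[symmetric] fun_eq_iff)

lemma entry_tensor: "entry (tensor i j a) k l = (if k = i \<and> l = j then a else 0)"
  by (simp add: tensor_def Smat_inverse)

lemma tensor_mult:
  assumes "par a = (- 1) ^ d * a"
  shows "tensor i j a * tensor k l b =
    (if j = k then tensor i l ((- 1) ^ (d * (bar k + bar l)) * a * b) else 0)"
proof (rule smat_eqI)
  fix m n
  have sign: "par_pow e a = (- 1) ^ (d * e) * a" for e
  proof (induction e)
    case (Suc e)
    have par_sign: "par ((- 1) ^ n * x) = (- 1) ^ n * par x" for n x
      using par_add[of x "- x"] by (cases "even n") (simp_all add: add_eq_0_iff)
    have "par_pow (Suc e) a = par (par_pow e a)"
      by (simp add: par_pow_def)
    also have "\<dots> = (- 1) ^ (d * e) * ((- 1) ^ d * a)"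
      by (simp only: Suc par_sign assms)
    also have "\<dots> = (- 1) ^ (d * Suc e) * a"
      by (simp only: mult_Suc_right add.commute[of d] power_add mult.assoc)
    finally show ?case .
  qed simp
  have "entry (tensor i j a * tensor k l b) m n =
      (\<Sum>p\<in>{1, - 1}. par_pow (bar p + bar n) (if m = i \<and> p = j then a else 0)
        * (if p = k \<and> n = l then b else 0))"
    by (simp only: times_smat.rep_eq entry_tensor)
  also have "\<dots> = (\<Sum>p\<in>{1, - 1}. if p = j then
      (if m = i \<and> n = l \<and> j = k then par_pow (bar j + bar l) a * b else 0) else 0)"
    by (rule sum.cong) auto
  also have "\<dots> = (if m = i \<and> n = l \<and> j = k then par_pow (bar j + bar l) a * b else 0)"
    using idx_exhaust[of j] by auto
  also have "\<dots> = entry (if j = k then tensor i l ((- 1) ^ (d * (bar k + bar l)) * a * b) else 0) m n"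
    by (simp add: entry_tensor zero_smat.rep_eq sign)
  finally show "entry (tensor i j a * tensor k l b) m n =
    entry (if j = k then tensor i l ((- 1) ^ (d * (bar k + bar l)) * a * b) else 0) m n" .
qed


section \<open>Formal series\<close>

text \<open>All one-variable power and Laurent series below are in \<open>X = 1/u\<close>; thus \<open>u\<close> is \<open>fls_X_inv\<close>.\<close>

text \<open>The inverse of a power series with constant term 1 over a non-commutative ring.\<close>

definition unit_inv :: "'a::ring_1 fps \<Rightarrow> 'a fps" where
  "unit_inv f = fps_right_inverse f 1"

lemma unit_inv:
  fixes f :: "'a::ring_1 fps"
  assumes "f $ 0 = 1"
  shows "f * unit_inv f = 1" "unit_inv f * f = 1"
  using fps_right_inverse[of f 1] fps_left_inverse[of 1 f]
    fps_left_inverse_eq_fps_right_inverse[of 1 f 1] assms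
  by (simp_all add: unit_inv_def)

definition tser :: "idx \<Rightarrow> idx \<Rightarrow> yangian fps" where
  "tser i j = Abs_fps (tY i j)"

definition Tmat :: "smat fps" where
  "Tmat = Abs_fps (\<lambda>r. Smat (\<lambda>i j. tY i j r))"

lemma Tmat_nth_0: "Tmat $ 0 = 1"
proof -
  have "tY i j 0 = (if i = j then 1 else 0)" for i j
    by (simp add: tY_def tF_def zero_yangian_def one_yangian_def)
  then show ?thesis
    by (simp add: Tmat_def one_smat_def)
qed

lemma Tmat_inverse: "Tmat * unit_inv Tmat = 1" "unit_inv Tmat * Tmat = 1"
  by (simp_all add: unit_inv Tmat_nth_0)

definition ttilde :: "idx \<Rightarrow> idx \<Rightarrow> yangian fps" where
  "ttilde i j = Abs_fps (\<lambda>r. entry (unit_inv Tmat $ r) i j)"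

definition neg_u :: "yangian fps \<Rightarrow> yangian fps" where
  "neg_u f = Abs_fps (\<lambda>r. (- 1) ^ r * f $ r)"

definition Cser :: "yangian fps" where
  "Cser = tser 1 1 * neg_u (ttilde 1 1)"

definition Dser :: "yangian fps" where
  "Dser = tser 1 (- 1) * ttilde 1 (- 1)"

definition eta :: "nat \<Rightarrow> yangian" where
  "eta i = scal ((- 1/2) ^ i) * (supercomm (tY 1 1 2) ^^ i) (tY 1 (- 1) 1)"

text \<open>\<open>Z_even i\<close> is the element with index \<open>2i\<close>.\<close>

definition Z_even :: "nat \<Rightarrow> yangian" where
  "Z_even i = scal (1/2) * supercomm (eta 0) (eta (2 * i))"

definition Hser :: "yangian fps" where
  "Hser = Abs_fps (\<lambda>n. if odd n then Z_even ((n - 1) div 2) else 0)"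

definition Qser :: "yangian fps" where
  "Qser = (1 + Hser) * unit_inv (1 - Hser)"

lemma one_minus_Hser_inverse:
  "(1 - Hser) * unit_inv (1 - Hser) = 1" "unit_inv (1 - Hser) * (1 - Hser) = 1"
  by (simp_all add: unit_inv Hser_def)

lemma Qser_nth_0: "Qser $ 0 = 1"
  by (simp add: Qser_def Hser_def unit_inv_def)


subsection \<open>Scalar series\<close>

abbreviation uvar :: "complex fls" where "uvar \<equiv> fls_X_inv"

text \<open>The square root with leading term \<open>2u\<close>: the binomial series of exponent \<open>1/2\<close> at \<open>1/(4u\<^sup>2)\<close>.\<close>

definition delta :: "complex fls" where
  "delta = 2 * uvar * fps_to_fls (fps_binomial (1/2) oo (fps_const (1/4) * fps_X ^ 2))"

lemma delta_square: "delta ^ 2 = 1 + 4 * uvar ^ 2"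
proof -
  let ?b = "fps_binomial (1/2 :: complex)" and ?w = "fps_const (1/4) * fps_X ^ 2 :: complex fps"
  have "(?b oo ?w) ^ 2 = (?b ^ 2) oo ?w"
    by (simp add: fps_compose_power)
  also have "?b ^ 2 = 1 + fps_X"
    by (simp add: power2_eq_square fps_binomial_add_mult[symmetric] fps_binomial_1)
  also have "(1 + fps_X) oo ?w = 1 + ?w"
    by (simp add: fps_compose_add_distrib)
  finally have "fps_to_fls (?b oo ?w) ^ 2 = fps_to_fls (1 + ?w)"
    by (simp flip: fps_to_fls_power)
  also have "\<dots> = 1 + fls_const (1/4) * fls_X ^ 2"
    by (simp add: fls_times_fps_to_fls fps_to_fls_power)
  finally have "delta ^ 2 = 4 * uvar ^ 2 * (1 + fls_const (1/4) * fls_X ^ 2)"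
    by (simp add: delta_def power_mult_distrib)
  also have "\<dots> = 4 * uvar ^ 2 + (4 * fls_const (1/4)) * (uvar * fls_X) ^ 2"
    by (simp add: algebra_simps power_mult_distrib)
  also have "4 * fls_const (1/4 :: complex) = 1"
    by (simp flip: fls_const_numeral)
  also have "uvar * fls_X = 1"
    by (simp flip: fls_inverse_X)
  finally show ?thesis by simp
qed

definition rho :: "complex fls" where
  "rho = (delta - 1) / 2"

text \<open>Complex Laurent series as series with (central) coefficients in the Yangian.\<close>

lift_definition scal_fls :: "complex fls \<Rightarrow> yangian fls" is "\<lambda>f n. scal (f n)"
  by (erule MOST_mono) simp

text \<open>Substitution of \<open>w = u + \<dots>\<close> for \<open>u\<close>, that is of \<open>1/w\<close> for \<open>X\<close>. Here \<open>1/w\<close> is a power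
  series without constant term (see \<open>fls_subdegree_inverse_rho\<close>), so \<open>fls_regpart\<close> loses nothing.\<close>

definition subst_u :: "yangian fps \<Rightarrow> complex fls \<Rightarrow> yangian fps" where
  "subst_u f w = f oo fls_regpart (scal_fls (inverse w))"

lemma fls_subdegree_inverse_rho:
  "fls_subdegree (inverse rho) = 1" "fls_subdegree (inverse (rho + 1)) = 1"
proof -
  let ?r = "fps_binomial (1/2) oo (fps_const (1/4) * fps_X ^ 2) :: complex fps"
  have "?r $ 0 = 1" by simp
  then have "?r \<noteq> 0" "subdegree ?r = 0"
    by (metis fps_zero_nth zero_neq_one) (simp add: subdegree_eq_0_iff)
  then have "fls_subdegree (fps_to_fls ?r) = 0" "fps_to_fls ?r \<noteq> 0"
    by (simp_all add: fls_subdegree_fls_to_fps)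
  then have delta: "fls_subdegree delta = - 1" "delta \<noteq> 0"
    by (simp_all add: delta_def)
  have "fls_subdegree (delta - 1) = - 1" "fls_subdegree (delta + 1) = - 1"
    using fls_subdegree_diff_eq1[of delta 1] fls_subdegree_add_eq1[of delta 1] delta by simp_all
  moreover have "inverse rho = 2 * inverse (delta - 1)" "inverse (rho + 1) = 2 * inverse (delta + 1)"
    by (simp_all add: rho_def field_simps)
  moreover from calculation have "delta - 1 \<noteq> 0" "delta + 1 \<noteq> 0" by auto
  ultimately show "fls_subdegree (inverse rho) = 1" "fls_subdegree (inverse (rho + 1)) = 1"
    by simp_all
qed

lemma subst_Qser_nth_0: "subst_u Qser w $ 0 = 1"
  by (simp add: subst_u_def Qser_nth_0)

end

theory Submission
  imports Defs
begin

text \<open>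
  Write \<open>a\<close>, \<open>b\<close> for \<open>t\<^sub>1\<^sub>1(u)\<close>, \<open>t\<^sub>1\<^sub>,\<^sub>-\<^sub>1(u)\<close>, write \<open>c\<close>, \<open>d\<close> for the corresponding entries of \<open>T(u)\<close> inverse,
  and let a prime denote \<open>u \<mapsto> - u\<close>; the entries in the second row are \<open>b'\<close>, \<open>a'\<close> and \<open>d'\<close>, \<open>c'\<close>. Let
  \<open>h\<close> and \<open>e\<close> be the second coefficient of \<open>a\<close> and the first coefficient of \<open>b\<close>. Then \<open>C = ac'\<close> and
  \<open>D = bd\<close>. The series \<open>\<eta>(w) = \<Sum>\<^sub>i \<eta>\<^sub>i w\<^bsup>-i-1\<^esup>\<close> is characterised by \<open>[h, \<eta>(w)] = 2e - 2w \<eta>(w)\<close>, and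
  \<open>[e, \<eta>(w)] = 2H(w)\<close> once \<open>H\<close> is known to be odd. Hence everything can be computed from the adjoint
  actions of \<open>h\<close> and \<open>e\<close>, which are read off from the coefficients of \<open>u\<^bsup>-1\<^esup>\<close> and \<open>u\<^bsup>-2\<^esup>\<close> in the
  quadratic relation.

  The odd series \<open>x = ad\<close> is the key. With \<open>S = ac + a'c' - 1\<close>, the bracket with \<open>h\<close> maps \<open>x\<close> to
  \<open>(2u - 1)x - x' + (C - D + S)e\<close>, so the span of \<open>x\<close> and \<open>x'\<close> is stable modulo \<open>e\<close>, and the
  bracket has eigenvalues \<open>2\<rho>\<close> and \<open>-2(\<rho> + 1)\<close> there: this is where the square root
  \<open>\<delta> = 2\<rho> + 1\<close> comes from. The eigenvectors are \<open>x + \<beta>x'\<close> with \<open>\<beta> = 2u \<mp> \<delta>\<close>, the roots of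
  \<open>\<beta>\<^sup>2 = 4u\<beta> + 1\<close>, and by the characterisation of \<open>\<eta>(w)\<close> they are multiples of \<open>\<eta>(-\<rho>)\<close> and \<open>\<eta>(\<rho> + 1)\<close>.
  Comparing the brackets with \<open>e\<close> gives \<open>(f + S) H(w) = f - S\<close> for \<open>f = C - \<beta>D\<close> at both points
  (lemma \<open>eigenvector\<close>). With \<open>f\<^sub>\<mp>\<close> for \<open>\<beta> = 2u \<mp> \<delta>\<close> this means \<open>S = f\<^sub>- Q(\<rho>)\<close> and \<open>f\<^sub>+ = S Q(\<rho> + 1)\<close>. Since
  \<open>S = f\<^sub>- f\<^sub>+\<close> (lemma \<open>factor_S\<close>), it follows that \<open>f\<^sub>+ = Q(\<rho>)\<close> and that \<open>f\<^sub>-\<close> is inverse to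
  \<open>Q(\<rho> + 1)\<close>; solving these two linear equations for \<open>C\<close> and \<open>D\<close> gives the theorem.

  Three facts make this work: \<open>ad' + b'c' = 0\<close>, \<open>D\<close> is even, and \<open>C - C' = 4uD\<close>. Each of them
  follows from a single principle (lemma \<open>eq_0_if_degree_raised\<close>): a series \<open>Y\<close> vanishes if \<open>uY\<close> is
  obtained from \<open>Y\<close> by an operation, such as a bracket with \<open>h\<close>, that does not raise the degree in \<open>u\<close>.
  The same principle gives the uniqueness of \<open>\<eta>(w)\<close>. The three facts imply that \<open>C\<close>, \<open>D\<close> and
  \<open>S\<close> commute with \<open>h\<close> and \<open>e\<close>; this is the centrality on which the comparison rests, and it also shows that
  \<open>H\<close> is odd, since \<open>[\<eta>\<^sub>i, \<eta>\<^sub>j]\<close> is then annihilated by the bracket with \<open>h\<close>.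
\<close>

unbundle fps_syntax

section \<open>The entries of the generating matrix and of its inverse\<close>

text \<open>Rewrite rules for a product of two generators have to be supplied also in this form, because
  products are kept associated to the right.\<close>

lemma prod_companion: "x * y = w \<Longrightarrow> x * (y * z) = w * (z::'r::ring_1)"
  by (simp flip: mult.assoc)

lemma commute_left: "x * y = y * x \<Longrightarrow> x * (y * z) = y * (x * z)" for x y z :: "'a::ring_1"
  by (simp flip: mult.assoc)

text \<open>The setting of the introduction in an arbitrary ring. All the assumptions are carried into each other
  by \<open>u \<mapsto> - u\<close> together with an exchange of primed and unprimed elements (lemma \<open>flip\<close>), so every
  statement below has a primed companion. The signs of the super tensor product are absorbed: the
  inverse relations say that the matrices with rows \<open>(a, -b)\<close>, \<open>(b', a')\<close> and
  \<open>(c, -d)\<close>, \<open>(d', c')\<close> are inverse to each other in the ordinary sense.\<close>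

locale q1_series =
  fixes u h e a a' b b' c c' d d' :: "'r::ring_1"
  assumes u_central: "\<And>z. z * u = u * z"
    and h_a: "h * a - a * h = b * e + e * b'"
    and h_a': "h * a' - a' * h = b' * e + e * b"
    and h_b: "h * b - b * h = 2 * u * b - a * e - e * a'"
    and h_b': "h * b' - b' * h = - 2 * u * b' - a' * e - e * a"
    and e_a: "e * a - a * e = - b - b'"
    and e_a': "e * a' - a' * e = - b - b'"
    and e_b: "e * b + b * e = a' - a"
    and e_b': "e * b' + b' * e = a - a'"
    and ac: "a * c - b * d' = 1" and ad: "a * d + b * c' = 0"
    and ac': "a' * c' - b' * d = 1" and ad': "a' * d' + b' * c = 0"
    and ca: "c * a - d * b' = 1" and cb: "c * b + d * a' = 0"
    and ca': "c' * a' - d' * b = 1" and cb': "c' * b' + d' * a = 0"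
begin

lemma flip: "q1_series (- u) h e a' a b' b c' c d' d"
  by unfold_locales
    (use h_a h_a' h_b h_b' e_a e_a' e_b e_b' ac ac' ad ad' ca ca' cb cb' u_central
      in \<open>simp_all add: algebra_simps\<close>)

lemma first_column_cancel:
  assumes "a * X = b * Y" "b' * X = - (a' * Y)"
  shows "X = 0" "Y = 0"
proof -
  have "X = (c * a - d * b') * X" by (simp add: ca)
  also have "\<dots> = (c * b + d * a') * Y"
    by (simp add: left_diff_distrib mult.assoc assms) (simp add: algebra_simps)
  finally show "X = 0" by (simp add: cb)
  have "Y = (c' * a' - d' * b) * Y" by (simp add: ca')
  also have "\<dots> = - ((c' * b' + d' * a) * X)"
    using assms by (simp add: algebra_simps)
  finally show "Y = 0" by (simp add: cb')
qed

text \<open>The inverse of a matrix commutes with derivations up to the usual conjugation; concretely, the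
  differences of the two sides form a column that is annihilated by the matrix with rows
  \<open>(a, -b)\<close> and \<open>(b', a')\<close>.\<close>

lemma tilde_commutators:
  shows h_c: "h * c - c * h = - e * d' - d * e"
    and h_d': "h * d' - d' * h = - 2 * u * d' + e * c + c' * e"
    and e_c: "e * c - c * e = - d - d'"
    and e_d': "e * d' + d' * e = c - c'"
proof -
  have r: "a * h = h * a - b * e - e * b'" "a' * h = h * a' - b' * e - e * b"
    "b * h = h * b - 2 * u * b + a * e + e * a'" "b' * h = h * b' + 2 * u * b' + a' * e + e * a"
    "a * c = 1 + b * d'" "a' * d' = - b' * c" "a' * c' = 1 + b' * d" "a * d = - b * c'"
    "a * e = e * a + b + b'" "a' * e = e * a' + b + b'"
    "b * e = a' - a - e * b" "b' * e = a - a' - e * b'"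
    "a * u = u * a" "a' * u = u * a'" "b * u = u * b" "b' * u = u * b'"
    using h_a h_a' h_b h_b' ac ad ac' ad' e_a e_a' e_b e_b' u_central
    by (simp_all add: algebra_simps eq_neg_iff_add_eq_0)
  note rr = r r[THEN prod_companion]
  have 1: "a * (h * c - c * h + e * d' + d * e) = b * (h * d' - d' * h + 2 * u * d' - e * c - c' * e)"
   "b' * (h * c - c * h + e * d' + d * e) = - (a' * (h * d' - d' * h + 2 * u * d' - e * c - c' * e))"
    by (simp_all add: rr algebra_simps mult_2 mult_2_right)
  from first_column_cancel[OF this]
  show "h * c - c * h = - e * d' - d * e" "h * d' - d' * h = - 2 * u * d' + e * c + c' * e"
    by (simp_all add: algebra_simps)
  have 1: "a * (e * c - c * e + d + d') = b * (- (e * d' + d' * e - c + c'))"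
   "b' * (e * c - c * e + d + d') = - (a' * (- (e * d' + d' * e - c + c')))"
    by (simp_all add: rr algebra_simps mult_2 mult_2_right)
  from first_column_cancel[OF this]
  show "e * c - c * e = - d - d'" "e * d' + d' * e = c - c'"
    by (simp_all add: algebra_simps)
qed

lemmas flipped_tilde_commutators = q1_series.tilde_commutators[OF flip]

text \<open>Moving \<open>u\<close>, \<open>h\<close> and \<open>e\<close> to the left of the entries, and then applying the inverse relations,
  terminates, and decides the identities below for brackets with \<open>h\<close> and \<open>e\<close>.\<close>

lemma normal_order:
  "a * h = h * a - b * e - e * b'" "a' * h = h * a' - b' * e - e * b"
  "b * h = h * b - 2 * u * b + a * e + e * a'" "b' * h = h * b' + 2 * u * b' + a' * e + e * a"
  "c * h = h * c + e * d' + d * e" "c' * h = h * c' + e * d + d' * e"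
  "d * h = h * d - 2 * u * d - e * c' - c * e" "d' * h = h * d' + 2 * u * d' - e * c - c' * e"
  "a * e = e * a + b + b'" "a' * e = e * a' + b + b'"
  "b * e = a' - a - e * b" "b' * e = a - a' - e * b'"
  "c * e = e * c + d + d'" "c' * e = e * c' + d + d'"
  "d * e = c' - c - e * d" "d' * e = c - c' - e * d'"
  "a * u = u * a" "a' * u = u * a'" "b * u = u * b" "b' * u = u * b'"
  "c * u = u * c" "c' * u = u * c'" "d * u = u * d" "d' * u = u * d'" "e * u = u * e"
  "a * c = 1 + b * d'" "a' * d' = - b' * c" "a' * c' = 1 + b' * d" "a * d = - b * c'"
  using h_a h_a' h_b h_b' ac ad ac' ad' e_a e_a' e_b e_b' u_central
    tilde_commutators flipped_tilde_commutators
  by (simp_all add: algebra_simps eq_neg_iff_add_eq_0)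

lemmas normal_order' = normal_order normal_order[THEN prod_companion] algebra_simps mult_2 mult_2_right

text \<open>The crossing element \<open>n = ad' + b'c'\<close> satisfies \<open>2un = n + n' - [h, n]\<close>, whose right side does not
  raise the degree in \<open>u\<close>. For series in \<open>u\<close> this forces \<open>n = 0\<close>.\<close>

lemma h_crossing:
  "h * (a * d' + b' * c') - (a * d' + b' * c') * h =
    (1 - 2 * u) * (a * d' + b' * c') + (a' * d + b * c)"
  by (simp add: normal_order')

end

text \<open>Up to signs, the crossing relations say that the product of the transposes of \<open>T(u)\<close> and its
  inverse is diagonal. They are exactly what makes \<open>C\<close> commute with \<open>e\<close>.\<close>

locale q1_crossed = q1_series +
  assumes crossing: "a * d' = - b' * c'" and crossing': "a' * d = - b * c"
begin

lemma flip_crossed: "q1_crossed (- u) h e a' a b' b c' c d' d"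
  using flip crossing crossing' by (simp add: q1_crossed_def q1_crossed_axioms_def)

lemmas nf = normal_order' crossing crossing[THEN prod_companion] crossing' crossing'[THEN prod_companion]

text \<open>Here and below \<open>ac'\<close> is \<open>C\<close>, \<open>bd\<close> is \<open>D\<close> and \<open>ad\<close> is the odd series \<open>x\<close>.\<close>

lemma e_C: "e * (a * c') = (a * c') * e" by (simp add: nf)

lemma e_D: "e * (b * d) = (b * d) * e" by (simp add: nf)

lemma h_C: "h * (a * c') - (a * c') * h = b' * d' - b * d" by (simp add: nf)

lemma h_D: "h * (b * d) - (b * d) * h = 4 * u * (b * d) - a * c' + a' * c"
proof -
  have "4 * u * (b * d) = 2 * (u * (b * d)) + 2 * (u * (b * d))"
    by (simp add: mult.assoc flip: distrib_right)
  then show ?thesis by (simp add: nf)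
qed

lemma h_x: "h * (a * d) - (a * d) * h = (2 * u - 1) * (a * d) - a' * d'
    + (a * c' - b * d + (a * c + a' * c' - 1)) * e" by (simp add: nf)

lemma e_x: "e * (a * d) + (a * d) * e = a * c' - b * d - (a * c + a' * c' - 1)" by (simp add: nf)

text \<open>The products \<open>a'c \<cdot> ac'\<close> and \<open>bd \<cdot> b'd'\<close> both contain an inner product of an entry of the inverse
  with an entry of \<open>T\<close>, and replacing it by the inverse relation makes the remaining quartic terms
  cancel.\<close>

lemma quadratic: "a * c + a' * c' - 1 = (a' * c) * (a * c') - (b * d) * (b' * d')"
proof -
  have 1: "(a' * c) * (a * c') = a' * (c * a) * c'" by (simp add: mult.assoc)
  have 2: "(b * d) * (b' * d') = b * (d * b') * d'"  by (simp add: mult.assoc)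
  have 3: "c * a = 1 + d * b'" "d * b' = c * a - 1" using ca by (simp_all add: algebra_simps)
  have "(a' * c) * (a * c') = a' * c' + a' * d * (b' * c')"
    unfolding 1 3(1) by (simp add: algebra_simps)
  also have "b' * c' = - (a * d')" by (simp add: crossing)
  also have "(b * d) * (b' * d') = b * c * (a * d') - b * d'"
    unfolding 2 3(2) by (simp add: algebra_simps)
  moreover have "b * c = - (a' * d)" by (simp add: crossing')
  moreover have "b * d' = a * c - 1" using ac by (simp add: algebra_simps)
  ultimately show ?thesis by (simp only: mult_minus_left mult_minus_right) (simp add: algebra_simps)
qed

text \<open>The obstructions \<open>\<epsilon>\<close> and \<open>\<kappa>\<close> to \<open>D\<close> being even and to \<open>C - C' = 4uD\<close> are mapped to multiples of each
  other. Taking the bracket twice gives \<open>16u\<^sup>2\<epsilon> = [h, [h, \<epsilon>]] - 4\<epsilon>\<close>, so that degree considerations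
  apply again.\<close>

lemma double_bracket:
  fixes \<epsilon> \<kappa>
  defines "\<epsilon> \<equiv> b' * d' - b * d" and "\<kappa> \<equiv> a * c' - a' * c - 2 * u * (b * d + b' * d')"
  shows "h * \<epsilon> - \<epsilon> * h = 2 * \<kappa>"
    and "h * \<kappa> - \<kappa> * h = 2 * \<epsilon> + 8 * u * u * \<epsilon>"
proof -
  define C C' D D' where "C = a * c'" and "C' = a' * c" and "D = b * d" and "D' = b' * d'"
  have four: "4 * z = 2 * z + 2 * z" for z :: 'a
    by (simp flip: distrib_right)
  have eight: "8 * z = 2 * (2 * z + 2 * z)" for z :: 'a
    by (simp flip: distrib_right mult.assoc)
  have r: "h * C = C * h + D' - D" "h * C' = C' * h + D - D'"
    "h * D = D * h + 2 * (u * D) + 2 * (u * D) - C + C'"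
    "h * D' = D' * h - 2 * (u * D') - 2 * (u * D') - C' + C"
    using h_C h_D q1_crossed.h_C[OF flip_crossed] q1_crossed.h_D[OF flip_crossed]
    unfolding C_def[symmetric] C'_def[symmetric] D_def[symmetric] D'_def[symmetric]
    by (simp_all add: algebra_simps four)
  have t: "h * (2 * z) = 2 * (h * z)" "u * (2 * z) = 2 * (u * z)" "D * u = u * D" "D' * u = u * D'"
    "h * (u * z) = u * (h * z)" for z
    using u_central[of D] u_central[of D'] u_central[of h]
    by (simp_all add: mult_2 mult_2_right distrib_left) (simp flip: mult.assoc)
  show "h * \<epsilon> - \<epsilon> * h = 2 * \<kappa>"
    unfolding \<epsilon>_def \<kappa>_def C_def[symmetric] C'_def[symmetric] D_def[symmetric] D'_def[symmetric]
    by (simp add: algebra_simps r t mult_2)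
  show "h * \<kappa> - \<kappa> * h = 2 * \<epsilon> + 8 * u * u * \<epsilon>"
    unfolding \<epsilon>_def \<kappa>_def C_def[symmetric] C'_def[symmetric] D_def[symmetric] D'_def[symmetric]
    by (simp add: algebra_simps r t eight mult_2 mult_2_right)
qed

end

text \<open>By lemmas \<open>h_C\<close> and \<open>h_D\<close> the first two assumptions make \<open>C\<close> and \<open>D\<close> commute with \<open>h\<close>. The last
  assumption reflects that \<open>4u\<close> is invertible as a Laurent series.\<close>

locale q1_commuting = q1_crossed +
  assumes D_even: "b' * d' = b * d"
    and C_odd_part: "a * c' - a' * c = 4 * u * (b * d)"
    and u_cancel: "4 * u * z = 0 \<Longrightarrow> z = 0"
begin

definition C where "C = a * c'"
definition D where "D = b * d"
text \<open>As \<open>a'c' - 1 = b'd\<close>, this is the diagonal entry \<open>ac + b'd\<close> of the product of the transposes.\<close>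

definition S where "S = a * c + a' * c' - 1"

lemma C'_eq: "a' * c = C - 4 * u * D"
  using C_odd_part by (simp add: C_def D_def algebra_simps)

lemma four_u_central: "z * (4 * u) = 4 * u * z"
proof -
  have "z * 4 = 4 * z" using mult_of_nat_commute[of 4 z] by simp
  then show ?thesis by (metis mult.assoc u_central)
qed

lemma S_eq: "S = (a' * c) * C - D * D"
  using quadratic by (simp add: S_def C_def D_def D_even)

lemma S_eq': "S = C * (a' * c) - D * D"
  using q1_crossed.quadratic[OF flip_crossed] by (simp add: S_def C_def D_def D_even add.commute)

text \<open>The left side of lemma \<open>quadratic\<close> is invariant under \<open>u \<mapsto> - u\<close>, hence \<open>C'C = CC'\<close>; and \<open>C'\<close> differs
  from \<open>C\<close> by a multiple of \<open>D\<close>.\<close>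

lemma C_D_commute: "C * D = D * C"
proof -
  have "(a' * c) * C = C * (a' * c)" using S_eq S_eq' by simp
  then have "C * (4 * u) * D = 4 * u * D * C"
    by (simp only: C'_eq left_diff_distrib right_diff_distrib mult.assoc) simp
  then have "4 * u * (C * D - D * C) = 0"
    by (simp add: four_u_central[of C] right_diff_distrib mult.assoc)
  then show ?thesis using u_cancel by fastforce
qed

lemma h_commute: "h * C = C * h" "h * D = D * h" "h * S = S * h"
proof -
  show C: "h * C = C * h"
    using h_C by (simp add: C_def D_even)
  show D: "h * D = D * h"
    using h_D C_odd_part by (simp add: D_def algebra_simps)
  have "h * (u * z) = u * (h * z)" for z by (metis u_central mult.assoc)
  then have "h * (a' * c) = a' * c * h"
    using C D q1_crossed.h_C[OF flip_crossed] by (simp add: D_even)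
  with C D show "h * S = S * h"
    by (simp add: S_eq algebra_simps) (metis mult.assoc)
qed

lemma e_commute: "e * C = C * e" "e * D = D * e" "e * S = S * e"
proof -
  show C: "e * C = C * e" and D: "e * D = D * e"
    using e_C e_D by (simp_all add: C_def D_def)
  have "e * (a' * c) = a' * c * e"
    by (rule q1_crossed.e_C[OF flip_crossed])
  with C D show "e * S = S * e"
    by (simp add: S_eq algebra_simps) (metis mult.assoc)
qed

text \<open>In the application \<open>\<beta>\<close> is \<open>2u - \<delta>\<close> or \<open>2u + \<delta>\<close>, and \<open>4u - \<beta>\<close> is the other root.\<close>

context
  fixes \<beta> :: 'a
  assumes beta_central: "\<And>z. z * \<beta> = \<beta> * z"
    and beta_root: "\<beta> * \<beta> = 4 * u * \<beta> + 1"
begin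

lemma factor_S: "S = (C - \<beta> * D) * (C - (4 * u - \<beta>) * D)"
proof -
  define t where "t = 4 * u"
  have t: "z * t = t * z" for z unfolding t_def by (rule four_u_central)
  have r: "C * t = t * C" "D * t = t * D" "\<beta> * t = t * \<beta>" "C * \<beta> = \<beta> * C" "D * \<beta> = \<beta> * D"
    "C * D = D * C" "\<beta> * \<beta> = t * \<beta> + 1"
    by (rule t beta_central C_D_commute)+ (simp add: t_def beta_root)
  have "S = C * C - t * (D * C) - D * D"
    by (simp add: S_eq C'_eq t_def algebra_simps)
  also have "\<dots> = (C - \<beta> * D) * (C - (t - \<beta>) * D)"
    by (simp add: algebra_simps r r[THEN prod_companion])
  finally show ?thesis unfolding t_def .
qed

lemma beta_rules:
  "h * \<beta> = \<beta> * h" "h * (\<beta> * z) = \<beta> * (h * z)" "e * (\<beta> * z) = \<beta> * (e * z)"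
  "\<beta> * u = u * \<beta>" "\<beta> * (u * z) = u * (\<beta> * z)" "\<beta> * (2 * z) = 2 * (\<beta> * z)"
  "\<beta> * (\<beta> * z) = 4 * (u * (\<beta> * z)) + z" "4 * z = 2 * z + 2 * z"
proof -
  show "h * \<beta> = \<beta> * h" by (rule beta_central)
  show "h * (\<beta> * z) = \<beta> * (h * z)" "e * (\<beta> * z) = \<beta> * (e * z)"
    by (rule commute_left, rule beta_central)+
  show "\<beta> * u = u * \<beta>" by (rule u_central)
  then show "\<beta> * (u * z) = u * (\<beta> * z)" by (rule commute_left)
  show "\<beta> * (2 * z) = 2 * (\<beta> * z)" by (rule commute_left, rule beta_central[symmetric])
  have "\<beta> * (\<beta> * z) = (4 * u * \<beta> + 1) * z" by (simp add: beta_root flip: mult.assoc)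
  then show "\<beta> * (\<beta> * z) = 4 * (u * (\<beta> * z)) + z" by (simp add: distrib_right mult.assoc)
  show "4 * z = 2 * z + 2 * z" by (simp flip: distrib_right)
qed

text \<open>For the two roots, the eigenvalue \<open>2u - 1 - \<beta>\<close> is \<open>2\<rho>\<close> and \<open>-2(\<rho> + 1)\<close>.\<close>

lemma eigen_h:
  "h * (a * d + \<beta> * (a' * d')) - (a * d + \<beta> * (a' * d')) * h =
    (2 * u - 1 - \<beta>) * (a * d + \<beta> * (a' * d')) + (1 + \<beta>) * (C - \<beta> * D + S) * e"
proof -
  define x x' where "x = a * d" and "x' = a' * d'"
  have x: "h * x = x * h + (2 * u - 1) * x - x' + (C - D + S) * e"
    using h_x by (simp add: x_def x'_def C_def D_def S_def algebra_simps)
  have x': "h * x' = x' * h + (- 2 * u - 1) * x' - x + (C - 4 * u * D - D + S) * e"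
    using q1_crossed.h_x[OF flip_crossed]
    by (simp add: x_def x'_def C'_eq D_even S_def algebra_simps flip: D_def)
  show ?thesis unfolding x_def[symmetric] x'_def[symmetric]
    by (simp add: algebra_simps x x' beta_rules)
qed

lemma eigen_e:
  "e * (a * d + \<beta> * (a' * d')) + (a * d + \<beta> * (a' * d')) * e = (1 + \<beta>) * (C - \<beta> * D - S)"
proof -
  define x x' where "x = a * d" and "x' = a' * d'"
  have x: "e * x = - x * e + C - D - S"
    using e_x by (simp add: x_def x'_def C_def D_def S_def algebra_simps)
  have x': "e * x' = - x' * e + C - 4 * u * D - D - S"
    using q1_crossed.e_x[OF flip_crossed]
    by (simp add: x_def x'_def C'_eq D_even S_def algebra_simps flip: D_def)
  show ?thesis unfolding x_def[symmetric] x'_def[symmetric]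
    by (simp add: algebra_simps x x' beta_rules)
qed

end
end

section \<open>Relations in the Yangian\<close>

lemma abs_yangian_hom:
  "abs_yangian (p + q) = abs_yangian p + abs_yangian q"
  "abs_yangian (p - q) = abs_yangian p - abs_yangian q"
  "abs_yangian (- p) = - abs_yangian p"
  "abs_yangian (p * q) = abs_yangian p * abs_yangian q"
  by (simp_all add: plus_yangian.abs_eq minus_yangian.abs_eq uminus_yangian.abs_eq times_yangian.abs_eq)

lemma abs_tF: "abs_yangian (tF i j r) = tY i j r"
  by (simp add: tY.abs_eq)

lemma abs_yangian_1: "abs_yangian 1 = 1"
  by (simp add: one_yangian_def)

lemma abs_yangian_sign: "abs_yangian ((- 1) ^ n) = (- 1) ^ n"
  by (cases "even n") (simp_all add: abs_yangian_hom abs_yangian_1)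

lemma abs_yangian_relator: "p \<in> relators \<Longrightarrow> abs_yangian p = 0"
  using yideal.add[OF yideal.zero, of p 1 1]
  by (simp add: zero_yangian_def yangian.abs_eq_iff yrel_def)

lemma tY_minus: "tY (- i) (- j) r = (- 1) ^ r * tY i j r"
proof -
  have "(- 1) ^ r * tF i j r - tF (- i) (- j) r \<in> relators"
    unfolding relators_def by blast
  from abs_yangian_relator[OF this] show ?thesis
    by (simp only: abs_yangian_hom abs_yangian_sign abs_tF) simp
qed

lemma denominators:
  "(yvar ^ 2 - xvar ^ 2) * F = yvar * (yvar * F) - xvar * (xvar * F)"
  "xvar * yvar * (xvar + yvar) * F = xvar * (xvar * (yvar * F)) + xvar * (yvar * (yvar * F))"
  "xvar * yvar * (yvar - xvar) * F = xvar * (yvar * (yvar * F)) - xvar * (xvar * (yvar * F))"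
proof -
  have c: "yvar * xvar = xvar * yvar" by (rule fps_mult_fps_X_commute[symmetric])
  show "(yvar ^ 2 - xvar ^ 2) * F = yvar * (yvar * F) - xvar * (xvar * F)"
    by (simp add: power2_eq_square algebra_simps del: fps_const_mult)
  have "yvar * (xvar * F) = xvar * (yvar * F)"
    by (simp only: c flip: mult.assoc)
  then show "xvar * yvar * (xvar + yvar) * F = xvar * (xvar * (yvar * F)) + xvar * (yvar * (yvar * F))"
    "xvar * yvar * (yvar - xvar) * F = xvar * (yvar * (yvar * F)) - xvar * (xvar * (yvar * F))"
    by (simp_all add: algebra_simps del: fps_const_mult)
qed

text \<open>The coefficients of \<open>x\<close> and \<open>x\<^sup>2\<close> yield the brackets with \<open>e\<close> and \<open>h\<close>. The shift by 2
  in the inner index divides by \<open>y\<^sup>2\<close>.\<close>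

lemma cleared_nth:
  defines "E K F G \<equiv> (yvar ^ 2 - xvar ^ 2) * K - (xvar * yvar * (xvar + yvar) * F
     - xvar * yvar * (yvar - xvar) * G)"
  shows "E K F G $ 1 $ (s + 2) = K $ 1 $ s - (F $ 0 $ s - G $ 0 $ s)"
    and "E K F G $ 2 $ (s + 2) = K $ 2 $ s - K $ 0 $ (s + 2)
      - (F $ 0 $ (s + 1) + F $ 1 $ s - (G $ 1 $ s - G $ 0 $ (s + 1)))"
  unfolding E_def denominators by (simp_all add: numeral_2_eq_2)

lemma sign_nth_nth: "((- 1) ^ n * F) $ r $ s = (- 1) ^ n * (F $ r $ s)" for F :: "falg fps fps"
  by (simp add: minus_one_power_fps_nth)

lemma tu_tv_nth: "(tu i j * tv k l) $ r $ s = tF i j r * tF k l s"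
  "(tv k l * tu i j) $ r $ s = tF k l s * tF i j r"
  by (simp_all add: tu_def tv_def)

lemma quad_rel_nth:
  "abs_yangian (quad_rel i j k l $ r $ s) = 0"
  by (rule abs_yangian_relator) (unfold relators_def, blast)

lemma tY_0: "tY i j 0 = (if i = j then 1 else 0)"
  by (simp add: tY_def tF_def zero_yangian_def one_yangian_def)

lemma quadratic_relations:
  fixes i j k l s
  defines "K r \<equiv> (- 1) ^ (bar i * bar k + bar i * bar l + bar k * bar l) *
     (tY i j r * tY k l s - (- 1) ^ ((bar i + bar j) * (bar k + bar l)) * (tY k l s * tY i j r))"
  and "F r m \<equiv> tY k j r * tY i l m - tY k j m * tY i l r"
  and "G r m \<equiv> (- 1) ^ (bar k + bar l) * (tY (- k) j r * tY (- i) l m - tY k (- j) m * tY i (- l) r)"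
  shows "K 1 = F 0 s - G 0 s"
    and "K 2 = F 1 s - G 1 s + F 0 (s + 1) + G 0 (s + 1)"
proof -
  note red = sign_nth_nth supercomm_uv_def fps_sub_nth tu_tv_nth
    abs_yangian_hom abs_yangian_sign abs_tF
  show "K 1 = F 0 s - G 0 s"
    using quad_rel_nth[of i j k l 1 "s + 2"] unfolding quad_rel_def cleared_nth
    unfolding red K_def F_def G_def by simp
  have z: "tY i j 0 * y - (- 1) ^ ((bar i + bar j) * n) * (y * tY i j 0) = 0" for n y
    by (cases "i = j") (simp_all add: tY_0 flip: mult_2)
  have rearrange: "p = f1 - g1 + f0 + g0" if "p - (f0 + f1 - (g1 - g0)) = 0"
    for p f0 f1 g0 g1 :: yangian
    using that by (simp add: algebra_simps)
  show "K 2 = F 1 s - G 1 s + F 0 (s + 1) + G 0 (s + 1)"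
    using quad_rel_nth[of i j k l 2 "s + 2"] unfolding quad_rel_def cleared_nth
    unfolding red K_def F_def G_def z mult_zero_right diff_zero by (rule rearrange)
qed

lemma sign_left_commute: "x * ((- 1) ^ n * y) = (- 1) ^ n * (x * y)" for x y :: "'c::ring_1"
  by (cases "even n") simp_all

lemma tY_neg: "tY (- 1) (- 1) r = (- 1) ^ r * tY 1 1 r" "tY (- 1) 1 r = (- 1) ^ r * tY 1 (- 1) r"
  using tY_minus[of 1 1] tY_minus[of 1 "- 1"] by simp_all

text \<open>The even generator defining the sequence \<open>\<eta>\<^sub>i\<close>, and the odd generator \<open>\<eta>\<^sub>0\<close>.\<close>

definition hgen :: yangian where "hgen = tY 1 1 2"
definition ogen :: yangian where "ogen = tY 1 (- 1) 1"

lemma gen_commutators: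
  "hgen * tY 1 1 s - tY 1 1 s * hgen = tY 1 (- 1) s * ogen + (- 1) ^ s * (ogen * tY 1 (- 1) s)"
  "hgen * tY 1 (- 1) s - tY 1 (- 1) s * hgen =
    2 * tY 1 (- 1) (s + 1) - tY 1 1 s * ogen - (- 1) ^ s * (ogen * tY 1 1 s)"
  "ogen * tY 1 1 s - tY 1 1 s * ogen = - tY 1 (- 1) s - (- 1) ^ s * tY 1 (- 1) s"
  "ogen * tY 1 (- 1) s + tY 1 (- 1) s * ogen = (- 1) ^ s * tY 1 1 s - tY 1 1 s"
  unfolding hgen_def ogen_def
  using quadratic_relations[where i = 1 and j = 1 and k = 1 and l = 1 and s = s]
    quadratic_relations[where i = 1 and j = 1 and k = 1 and l = "- 1" and s = s]
    quadratic_relations[where i = 1 and j = "- 1" and k = 1 and l = 1 and s = s]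
    quadratic_relations[where i = 1 and j = "- 1" and k = 1 and l = "- 1" and s = s]
  by (simp_all add: tY_0 tY_neg mult_2 sign_left_commute mult.assoc)

subsection \<open>The inverse matrix\<close>

definition entry_fps :: "smat fps \<Rightarrow> idx \<Rightarrow> idx \<Rightarrow> yangian fps" where
  "entry_fps F i j = Abs_fps (\<lambda>n. entry (F $ n) i j)"

definition par_fps :: "yangian fps \<Rightarrow> yangian fps" where
  "par_fps f = Abs_fps (\<lambda>n. par (f $ n))"

lemma entry_sum: "entry (sum f A) i j = (\<Sum>x\<in>A. entry (f x) i j)"
  by (induction A rule: infinite_finite_induct) (simp_all add: zero_smat.rep_eq plus_smat.rep_eq)

lemma par_sum: "par (sum f A) = (\<Sum>x\<in>A. par (f x))"
  by (induction A rule: infinite_finite_induct) (simp_all add: par_add)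

lemma par_uminus: "par (- x) = - par x"
  using par_add[of x "- x"] by (simp add: add_eq_0_iff)

lemma par_fps_simps:
  "par_fps (f * g) = par_fps f * par_fps g" "par_fps (f + g) = par_fps f + par_fps g"
  "par_fps (- f) = - par_fps f" "par_fps 0 = 0" "par_fps (par_fps f) = f"
  by (simp_all add: par_fps_def fps_eq_iff fps_mult_nth par_sum par_mult par_add par_uminus)

lemma entry_fps_mult:
  "entry_fps (F * G) i 1 = entry_fps F i 1 * entry_fps G 1 1 +
    par_fps (entry_fps F i (- 1)) * entry_fps G (- 1) 1"
  "entry_fps (F * G) i (- 1) = par_fps (entry_fps F i 1) * entry_fps G 1 (- 1) +
    entry_fps F i (- 1) * entry_fps G (- 1) (- 1)"
  by (simp_all add: entry_fps_def par_fps_def fps_eq_iff fps_mult_nth entry_sum times_smat.rep_eq sum.distrib)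

lemma entry_fps_1: "entry_fps 1 i j = (if i = j then 1 else 0)"
  by (simp add: entry_fps_def fps_eq_iff fps_one_nth one_smat.rep_eq zero_smat.rep_eq)

lemma entry_fps_Tmat: "entry_fps Tmat = tser" "entry_fps (unit_inv Tmat) = ttilde"
  by (simp_all add: entry_fps_def Tmat_def tser_def ttilde_def fun_eq_iff Smat_inverse)

lemma neg_u_mult: "neg_u (f * g) = neg_u f * neg_u g"
proof (rule fps_ext)
  fix n
  have "(- 1) ^ n * (f $ i * g $ (n - i)) = (- 1) ^ i * f $ i * ((- 1) ^ (n - i) * g $ (n - i))"
    if "i \<le> n" for i
    using that by (simp add: mult.assoc sign_left_commute[of "f $ i"])
      (simp flip: mult.assoc power_add)
  then show "neg_u (f * g) $ n = (neg_u f * neg_u g) $ n"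
    by (simp add: neg_u_def fps_mult_nth sum_distrib_left)
qed

lemma neg_u_simps: "neg_u (f + g) = neg_u f + neg_u g" "neg_u (f - g) = neg_u f - neg_u g"
  "neg_u (- f) = - neg_u f" "neg_u 0 = 0" "neg_u 1 = 1" "neg_u (neg_u f) = f"
  by (auto simp: neg_u_def fps_eq_iff algebra_simps simp flip: mult.assoc power_add)

lemma tser_neg: "tser (- 1) (- 1) = neg_u (tser 1 1)" "tser (- 1) 1 = neg_u (tser 1 (- 1))"
  by (simp_all add: tser_def neg_u_def fps_eq_iff tY_neg)

lemma par_tser: "par_fps (tser 1 1) = tser 1 1" "par_fps (tser 1 (- 1)) = - tser 1 (- 1)"
  "par_fps (tser (- 1) 1) = - tser (- 1) 1" "par_fps (tser (- 1) (- 1)) = tser (- 1) (- 1)"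
  by (simp_all add: tser_def par_fps_def fps_eq_iff par_tY)

text \<open>The entries of the inverse are not given as homogeneous elements with the symmetry
  \<open>u \<mapsto> - u\<close>; both properties come from uniqueness of the inverse. After the parity
  automorphism has been applied to two of the four left inverse relations, the signs disappear, and the
  left and right inverse relations are those of an ordinary two-by-two matrix.\<close>

lemma inverse_relations:
  defines "a \<equiv> tser 1 1" and "b \<equiv> tser 1 (- 1)" and "c \<equiv> ttilde 1 1" and "d \<equiv> ttilde 1 (- 1)"
  shows "a * c - b * neg_u d = 1" "a * d + b * neg_u c = 0"
    and "c * a - d * neg_u b = 1" "c * b + d * neg_u a = 0"
proof -
  define a' b' where "a' = neg_u a" and "b' = neg_u b"
  define c2 d2 where "c2 = ttilde (- 1) (- 1)" and "d2 = ttilde (- 1) 1"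
  note ser = entry_fps_mult entry_fps_Tmat tser_neg par_tser par_tser[unfolded tser_neg] entry_fps_1
  have r: "a * c - b * d2 = 1" "a * d + b * c2 = 0" "b' * c + a' * d2 = 0" "a' * c2 - b' * d = 1"
    using arg_cong[OF Tmat_inverse(1), of "\<lambda>F. entry_fps F 1 1"]
      arg_cong[OF Tmat_inverse(1), of "\<lambda>F. entry_fps F 1 (- 1)"]
      arg_cong[OF Tmat_inverse(1), of "\<lambda>F. entry_fps F (- 1) 1"]
      arg_cong[OF Tmat_inverse(1), of "\<lambda>F. entry_fps F (- 1) (- 1)"]
    unfolding ser by (simp_all add: a_def b_def c_def d_def a'_def b'_def c2_def d2_def)
  have l: "c * a + par_fps d * b' = 1" "par_fps c * b + d * a' = 0"
    "d2 * a + par_fps c2 * b' = 0" "par_fps d2 * b + c2 * a' = 1"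
    using arg_cong[OF Tmat_inverse(2), of "\<lambda>F. entry_fps F 1 1"]
      arg_cong[OF Tmat_inverse(2), of "\<lambda>F. entry_fps F 1 (- 1)"]
      arg_cong[OF Tmat_inverse(2), of "\<lambda>F. entry_fps F (- 1) 1"]
      arg_cong[OF Tmat_inverse(2), of "\<lambda>F. entry_fps F (- 1) (- 1)"]
    unfolding ser by (simp_all add: a_def b_def c_def d_def a'_def b'_def c2_def d2_def)
  have p: "par_fps a = a" "par_fps b = - b" "par_fps a' = a'" "par_fps b' = - b'"
    using par_tser unfolding tser_neg by (simp_all add: a_def b_def a'_def b'_def)
  have l2: "par_fps d * a' = c * b"
    using arg_cong[OF l(2), of par_fps] by (simp add: par_fps_simps p)
  have l3: "par_fps d2 * a = c2 * b'"
    using arg_cong[OF l(3), of par_fps] by (simp add: par_fps_simps p)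
  have uniq: "X = c \<and> Y = - par_fps d2" if "a * X - b * Y = 1" "b' * X + a' * Y = 0" for X Y
  proof
    have "X = (c * a + par_fps d * b') * X" by (simp add: l)
    also have "\<dots> = c * (a * X - b * Y) + par_fps d * (b' * X + a' * Y)"
      by (simp add: algebra_simps) (simp add: l2 flip: mult.assoc)
    finally show "X = c" by (simp add: that)
    have "Y = (par_fps d2 * b + c2 * a') * Y" by (simp add: l)
    also have "\<dots> = - par_fps d2 * (a * X - b * Y) + c2 * (b' * X + a' * Y)"
      by (simp add: algebra_simps) (simp add: l3 flip: mult.assoc)
    finally show "Y = - par_fps d2" by (simp add: that)
  qed
  \<comment> \<open>\<open>par d\<close> is an entry of the left inverse and \<open>- d\<close> the same entry of the right inverse.\<close>
  have "par_fps d = par_fps d * (a' * c2 - b' * d)" by (simp add: r)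
  also have "\<dots> = (par_fps d * a') * c2 - (par_fps d * b') * d" by (simp add: algebra_simps)
  also have "par_fps d * b' = 1 - c * a" using l(1) by (simp add: algebra_simps)
  also have "(par_fps d * a') * c2 - (1 - c * a) * d = c * (a * d + b * c2) - d"
    by (simp add: l2 algebra_simps)
  finally have pd: "par_fps d = - d" by (simp add: r)
  \<comment> \<open>The flipped second column of the right inverse solves the equations of the first column.\<close>
  have "a * neg_u c2 - b * neg_u d = 1"  "b' * neg_u c2 + a' * neg_u d = 0"
    using arg_cong[OF r(4), of neg_u] arg_cong[OF r(2), of neg_u]
    by (simp_all add: neg_u_simps neg_u_mult a'_def b'_def add.commute)
  with uniq[OF this] uniq[OF r(1,3)] have "neg_u c2 = c" "neg_u d = d2" by simp_all
  then have c2: "c2 = neg_u c" "d2 = neg_u d" by (metis neg_u_simps(6))+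
  show "a * c - b * neg_u d = 1" "a * d + b * neg_u c = 0" using r c2 by simp_all
  show "c * a - d * neg_u b = 1" "c * b + d * neg_u a = 0" using l(1) l2 pd
    by (simp_all add: a'_def b'_def flip: l2)
qed

subsection \<open>Brackets in terms of series\<close>

lemma neg_u_const: "neg_u (fps_const x) = fps_const x" and neg_u_X: "neg_u fps_X = - fps_X"
  by (auto simp: neg_u_def fps_eq_iff fps_X_def)

lemma series_commutators:
  defines "a \<equiv> tser 1 1" and "b \<equiv> tser 1 (- 1)" and "h \<equiv> fps_const hgen" and "o1 \<equiv> fps_const ogen"
  shows "h * a - a * h = b * o1 + o1 * neg_u b"
    and "fps_X * (h * b - b * h + a * o1 + o1 * neg_u a) = b + b"
    and "o1 * a - a * o1 = - b - neg_u b"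
    and "o1 * b + b * o1 = neg_u a - a"
proof -
  note d = a_def b_def h_def o1_def tser_def neg_u_def fps_eq_iff gen_commutators sign_left_commute
  show "h * a - a * h = b * o1 + o1 * neg_u b" "o1 * a - a * o1 = - b - neg_u b"
    "o1 * b + b * o1 = neg_u a - a"
    by (simp_all add: d)
  show "fps_X * (h * b - b * h + a * o1 + o1 * neg_u a) = b + b"
  proof (rule fps_ext)
    fix n show "(fps_X * (h * b - b * h + a * o1 + o1 * neg_u a)) $ n = (b + b) $ n"
      by (cases n) (simp_all add: d tY_0 mult_2)
  qed
qed

section \<open>Scalar series and degrees\<close>

lemma scal_simps: "scal (- x) = - scal x" "scal (x - y) = scal x - scal y"
  "scal (sum f A) = (\<Sum>x\<in>A. scal (f x))"
proof -
  show "scal (- x) = - scal x" for x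
    using scal_add[of x "- x"] by (simp add: add_eq_0_iff)
  from this[of y] show "scal (x - y) = scal x - scal y"
    using scal_add[of x "- y"] by simp
  show "scal (sum f A) = (\<Sum>x\<in>A. scal (f x))"
    by (induction A rule: infinite_finite_induct) (simp_all add: scal_add)
qed

lemma scal_numeral: "scal (numeral n) = numeral n"
proof -
  have "scal (of_nat n) = of_nat n" for n
    by (induction n) (simp_all add: scal_add)
  from this[of "numeral n"] show ?thesis by simp
qed

lemma scal_mult_cancel: "c \<noteq> 0 \<Longrightarrow> scal c * x = 0 \<Longrightarrow> x = 0"
  by (metis mult.assoc mult_1_left mult_zero_right scal_1 scal_mult left_inverse)

lemma scal_eq_0_iff [simp]: "scal c = 0 \<longleftrightarrow> c = 0"
  using scal_mult_cancel[of c 1] by auto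

lemma scal_fls_nth [simp]: "scal_fls f $$ n = scal (f $$ n)"
  by (simp add: scal_fls.rep_eq)

lemma scal_fls_add: "scal_fls (f + g) = scal_fls f + scal_fls g"
  and scal_fls_diff: "scal_fls (f - g) = scal_fls f - scal_fls g"
  and scal_fls_0: "scal_fls 0 = 0" and scal_fls_1: "scal_fls 1 = 1"
  and scal_fls_uvar: "scal_fls uvar = fls_X_inv"
  by (simp_all add: fls_eq_iff scal_add scal_simps)

lemma scal_fls_numeral: "scal_fls (numeral n) = numeral n"
proof -
  have "scal_fls (of_nat n) = of_nat n" for n
    by (induction n) (simp_all add: scal_fls_add scal_fls_0 scal_fls_1)
  from this[of "numeral n"] show ?thesis by simp
qed

lemma fls_subdegree_scal_fls: "fls_subdegree (scal_fls f) = fls_subdegree f"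
proof (cases "f = 0")
  case False
  then show ?thesis by (intro fls_subdegree_eqI) simp_all
qed (simp add: scal_fls_0)

lemma scal_fls_mult: "scal_fls (f * g) = scal_fls f * scal_fls g"
  by (rule fls_eqI)
    (simp add: fls_times_nth(2) fls_subdegree_scal_fls scal_simps scal_mult)

lemma scal_fls_central: "scal_fls z * f = f * scal_fls z"
proof (rule fls_eqI)
  fix n
  show "(scal_fls z * f) $$ n = (f * scal_fls z) $$ n"
    unfolding fls_times_nth(2)
    by (rule sum.reindex_bij_witness[of _ "\<lambda>i. n - i" "\<lambda>i. n - i"])
      (auto simp: scal_central)
qed

lemma scal_fls_cancel:
  assumes "z \<noteq> 0" "scal_fls z * f = 0"
  shows "f = 0"
proof -
  have "f = scal_fls (inverse z * z) * f" using assms by (simp add: scal_fls_1)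
  also have "\<dots> = scal_fls (inverse z) * (scal_fls z * f)"
    by (simp add: scal_fls_mult mult.assoc)
  finally show ?thesis by (simp add: assms)
qed

text \<open>Multiplication by \<open>w\<close>, which has positive degree in \<open>u\<close>, strictly raises the degree of a nonzero
  \<open>Y\<close>, whereas \<open>L\<close>, thought of as the image of \<open>Y\<close> under an operation on coefficients, does not.\<close>

lemma eq_0_if_degree_raised:
  assumes w: "fls_subdegree w < 0"
    and eq: "scal_fls w * Y = L"
    and L: "\<And>N. \<forall>k<N. Y $$ k = 0 \<Longrightarrow> \<forall>k<N. L $$ k = 0"
  shows "Y = 0"
proof (rule ccontr)
  assume Y: "Y \<noteq> 0"
  define N where "N = fls_subdegree Y"
  have "L $$ (fls_subdegree w + N) = 0"
    using L[of N] w by (simp add: N_def)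
  moreover have "L $$ (fls_subdegree w + N) = scal (w $$ fls_subdegree w) * Y $$ N"
    using fls_times_base[of "scal_fls w" Y]
    by (simp add: eq N_def fls_subdegree_scal_fls)
  moreover have "w $$ fls_subdegree w \<noteq> 0"
    using w by (intro nth_fls_subdegree_nonzero) auto
  ultimately have "Y $$ N = 0" using scal_mult_cancel by metis
  then show False using Y by (simp add: N_def)
qed

section \<open>The Yangian series satisfy the algebraic relations\<close>

definition "h_fls = fls_const hgen"
definition "e_fls = fls_const ogen"
definition "a_fls = fps_to_fls (tser 1 1)"
definition "b_fls = fps_to_fls (tser 1 (- 1))"
definition "c_fls = fps_to_fls (ttilde 1 1)"
definition "d_fls = fps_to_fls (ttilde 1 (- 1))"
definition "a_fls' = fps_to_fls (neg_u (tser 1 1))"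
definition "b_fls' = fps_to_fls (neg_u (tser 1 (- 1)))"
definition "c_fls' = fps_to_fls (neg_u (ttilde 1 1))"
definition "d_fls' = fps_to_fls (neg_u (ttilde 1 (- 1)))"

lemmas series_defs = h_fls_def e_fls_def a_fls_def b_fls_def c_fls_def d_fls_def
  a_fls'_def b_fls'_def c_fls'_def d_fls'_def

lemma yangian_series: "q1_series fls_X_inv h_fls e_fls
  a_fls a_fls' b_fls b_fls' c_fls c_fls' d_fls d_fls'"
proof
  show "z * fls_X_inv = fls_X_inv * z" for z :: "yangian fls"
    by (metis scal_fls_central scal_fls_uvar)
  define F :: "yangian fps \<Rightarrow> yangian fls" where "F = fps_to_fls"
  have F: "F (f * g) = F f * F g" "F (f + g) = F f + F g" "F (f - g) = F f - F g" "F (- f) = - F f"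
    "F 1 = 1" "F 0 = 0" "F fps_X = fls_X" "F (fps_const x) = fls_const x" for f g x
    by (simp_all add: F_def fls_times_fps_to_fls)
  have N: "neg_u (neg_u f) = f" "neg_u (fps_const x) = fps_const x" for f x
    by (simp_all add: neg_u_simps neg_u_const)
  note d = series_defs[folded F_def]
  note r = series_commutators inverse_relations
  note r' = r[THEN arg_cong[where f = F], unfolded F]
  note n = r[THEN arg_cong[where f = neg_u], unfolded neg_u_simps neg_u_mult neg_u_const neg_u_X,
    THEN arg_cong[where f = F], unfolded F]
  show "h_fls * a_fls - a_fls * h_fls = b_fls * e_fls + e_fls * b_fls'"
    "e_fls * a_fls - a_fls * e_fls = - b_fls - b_fls'" "e_fls * b_fls + b_fls * e_fls = a_fls' - a_fls"
    "a_fls * c_fls - b_fls * d_fls' = 1" "a_fls * d_fls + b_fls * c_fls' = 0"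
    "c_fls * a_fls - d_fls * b_fls' = 1" "c_fls * b_fls + d_fls * a_fls' = 0"
    unfolding d by (fact r')+
  show "h_fls * a_fls' - a_fls' * h_fls = b_fls' * e_fls + e_fls * b_fls"
    "e_fls * a_fls' - a_fls' * e_fls = - b_fls - b_fls'" "e_fls * b_fls' + b_fls' * e_fls = a_fls - a_fls'"
    "a_fls' * c_fls' - b_fls' * d_fls = 1" "a_fls' * d_fls' + b_fls' * c_fls = 0"
    "c_fls' * a_fls' - d_fls' * b_fls = 1" "c_fls' * b_fls' + d_fls' * a_fls = 0"
    unfolding d using n by (simp_all add: algebra_simps)
  have cancel: "fls_X_inv * (fls_X * z) = z" for z :: "yangian fls"
    by (simp add: fls_X_inv_times_conv_shift fls_X_times_conv_shift)
  have 1: "h_fls * b_fls - b_fls * h_fls + a_fls * e_fls + e_fls * a_fls' = fls_X_inv * (b_fls + b_fls)"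
    unfolding d r'(2)[symmetric] cancel ..
  have 2: "h_fls * b_fls' - b_fls' * h_fls + a_fls' * e_fls + e_fls * a_fls = - (fls_X_inv * (b_fls' + b_fls'))"
    unfolding d n(2)[symmetric] by (simp add: cancel)
  show "h_fls * b_fls - b_fls * h_fls = 2 * fls_X_inv * b_fls - a_fls * e_fls - e_fls * a_fls'"
    using 1 by (simp add: algebra_simps mult_2)
  show "h_fls * b_fls' - b_fls' * h_fls = - 2 * fls_X_inv * b_fls' - a_fls' * e_fls - e_fls * a_fls"
    using 2 by (simp add: algebra_simps mult_2)
qed

lemma bracket_lowest:
  assumes "\<forall>k<N. f $$ k = 0"
  shows "\<forall>k<N. (h_fls * f - f * h_fls) $$ k = 0"
  using assms by (simp add: h_fls_def)

lemma yangian_crossed: "q1_crossed fls_X_inv h_fls e_fls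
  a_fls a_fls' b_fls b_fls' c_fls c_fls' d_fls d_fls'"
proof -
  interpret q1_series fls_X_inv h_fls e_fls
  a_fls a_fls' b_fls b_fls' c_fls c_fls' d_fls d_fls'
    by (rule yangian_series)
  define f where "f = tser 1 1 * neg_u (ttilde 1 (- 1)) + neg_u (tser 1 (- 1)) * neg_u (ttilde 1 1)"
  \<comment> \<open>The crossing element of lemma \<open>h_crossing\<close>.\<close>
  have f: "fps_to_fls f = a_fls * d_fls' + b_fls' * c_fls'"
    "fps_to_fls (neg_u f) = a_fls' * d_fls + b_fls * c_fls"
    by (simp_all add: f_def series_defs neg_u_simps neg_u_mult fls_times_fps_to_fls)
  have "fps_to_fls f = 0"
  proof (rule eq_0_if_degree_raised)
    show "fls_subdegree (2 * uvar) < 0" by simp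
    show "scal_fls (2 * uvar) * fps_to_fls f =
      fps_to_fls f + fps_to_fls (neg_u f) - (h_fls * fps_to_fls f - fps_to_fls f * h_fls)"
      using h_crossing
      by (simp add: f[symmetric] scal_fls_mult scal_fls_numeral scal_fls_uvar left_diff_distrib)
    show "\<forall>k<N. (fps_to_fls f + fps_to_fls (neg_u f) - (h_fls * fps_to_fls f - fps_to_fls f * h_fls)) $$ k = 0"
      if "\<forall>k<N. fps_to_fls f $$ k = 0" for N
      using that by (auto simp: h_fls_def neg_u_def)
  qed
  then have "f = 0" by simp
  then have "a_fls * d_fls' + b_fls' * c_fls' = 0" "a_fls' * d_fls + b_fls * c_fls = 0"
    using f by (simp_all add: neg_u_simps)
  then show ?thesis
    by unfold_locales (simp_all add: eq_neg_iff_add_eq_0)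
qed

lemma yangian_central: "q1_commuting fls_X_inv h_fls e_fls
  a_fls a_fls' b_fls b_fls' c_fls c_fls' d_fls d_fls'"
proof -
  interpret q1_crossed fls_X_inv h_fls e_fls
  a_fls a_fls' b_fls b_fls' c_fls c_fls' d_fls d_fls'
    by (rule yangian_crossed)
  \<comment> \<open>The two obstructions of lemma \<open>double_bracket\<close>.\<close>
  define f where "f = b_fls' * d_fls' - b_fls * d_fls"
  define g where "g = a_fls * c_fls' - a_fls' * c_fls - 2 * fls_X_inv * (b_fls * d_fls + b_fls' * d_fls')"
  have fg: "h_fls * f - f * h_fls = 2 * g" "h_fls * g - g * h_fls = 2 * f + 8 * fls_X_inv * fls_X_inv * f"
    using double_bracket by (simp_all add: f_def g_def)
  have two: "g = 0" if "2 * g = 0" for g :: "yangian fls"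
    by (rule scal_fls_cancel[of 2]) (use that in \<open>simp_all add: scal_fls_numeral\<close>)
  define L where "L = h_fls * (h_fls * f - f * h_fls) - (h_fls * f - f * h_fls) * h_fls - 4 * f"
  have f0: "f = 0"
  proof (rule eq_0_if_degree_raised)
    show "fls_subdegree (16 * uvar * uvar) < 0" by simp
    have "h_fls * (2 * g) - (2 * g) * h_fls = 2 * (h_fls * g - g * h_fls)"
      by (simp add: algebra_simps mult_2 mult_2_right)
    then have "h_fls * (h_fls * f - f * h_fls) - (h_fls * f - f * h_fls) * h_fls = 2 * (2 * f + 8 * fls_X_inv * fls_X_inv * f)"
      unfolding fg by simp
    then show "scal_fls (16 * uvar * uvar) * f = L"
      by (simp add: L_def scal_fls_mult scal_fls_numeral scal_fls_uvar distrib_left flip: mult.assoc)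
    show "\<forall>k<N. L $$ k = 0" if "\<forall>k<N. f $$ k = 0" for N
      using that bracket_lowest[OF bracket_lowest, OF that] by (auto simp: L_def)
  qed
  then have "2 * g = 0" using fg(1) by simp
  then have g0: "g = 0" by (rule two)
  show ?thesis
  proof
    show D: "b_fls' * d_fls' = b_fls * d_fls" using f0 by (simp add: f_def)
    have "4 * fls_X_inv * (b_fls * d_fls) = 2 * fls_X_inv * (b_fls * d_fls + b_fls * d_fls)"
      by (simp only: distrib_left) (simp flip: distrib_right)
    with g0 show "a_fls * c_fls' - a_fls' * c_fls = 4 * fls_X_inv * (b_fls * d_fls)"
      by (simp add: g_def D)
    show "z = 0" if "4 * fls_X_inv * z = 0" for z :: "yangian fls"
      by (rule scal_fls_cancel[of "4 * uvar"])
        (use that in \<open>simp_all add: scal_fls_mult scal_fls_numeral scal_fls_uvar\<close>)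
  qed
qed

section \<open>Substitution of a scalar series\<close>

text \<open>Substituting a central series is a ring homomorphism, although the coefficients do not commute.\<close>

definition eval_at :: "complex fls \<Rightarrow> yangian fps \<Rightarrow> yangian fls" where
  "eval_at w f = fps_to_fls (subst_u f w)"

context
  fixes w :: "complex fls"
  assumes w: "fls_subdegree (inverse w) = 1"
begin

lemma w_nonzero: "w \<noteq> 0"
  using w by auto

lemma regpart_inverse: "fps_to_fls (fls_regpart (scal_fls (inverse w))) = scal_fls (inverse w)"
proof (rule fls_eqI)
  fix n
  have "inverse w $$ n = 0" if "n < 0" using that w by simp
  then show "fps_to_fls (fls_regpart (scal_fls (inverse w))) $$ n = scal_fls (inverse w) $$ n"
    by simp
qed

lemma scal_fls_power: "scal_fls (f ^ n) = scal_fls f ^ n"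
  by (induction n) (simp_all add: scal_fls_1 scal_fls_mult)

lemma regpart_inverse_power_nth:
  "(fls_regpart (scal_fls (inverse w)) ^ i) $ n = scal ((inverse w ^ i) $$ int n)"
proof -
  let ?g = "fls_regpart (scal_fls (inverse w))"
  have "fps_to_fls (?g ^ i) = scal_fls (inverse w ^ i)"
    by (simp add: fps_to_fls_power regpart_inverse scal_fls_power)
  then have "fps_to_fls (?g ^ i) $$ int n = scal ((inverse w ^ i) $$ int n)" by simp
  then show ?thesis by simp
qed

lemma inverse_power_nth_0: "n < int i \<Longrightarrow> (inverse w ^ i) $$ n = 0"
  using w by (intro fls_eq0_below_subdegree) (simp add: fls_subdegree_pow)

lemma eval_at_nth: "int N \<ge> n \<Longrightarrow> eval_at w f $$ n = (\<Sum>i\<le>N. f $ i * scal ((inverse w ^ i) $$ n))"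
proof (cases "n < 0")
  case False
  assume "int N \<ge> n"
  with False have "{0..nat n} \<subseteq> {..N}" by auto
  moreover have "f $ i * scal ((inverse w ^ i) $$ n) = 0" if "i \<in> {..N} - {0..nat n}" for i
  proof -
    have "n < int i" using that False by auto
    then show ?thesis by (simp add: inverse_power_nth_0)
  qed
  ultimately have "(\<Sum>i\<le>N. f $ i * scal ((inverse w ^ i) $$ n)) =
      (\<Sum>i=0..nat n. f $ i * scal ((inverse w ^ i) $$ n))"
    by (intro sum.mono_neutral_right) auto
  with False show ?thesis
    by (simp add: eval_at_def subst_u_def fps_compose_nth regpart_inverse_power_nth)
qed (simp add: eval_at_def inverse_power_nth_0)

lemma eval_at_add: "eval_at w (f + g) = eval_at w f + eval_at w g"
  and eval_at_diff: "eval_at w (f - g) = eval_at w f - eval_at w g"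
  by (simp_all add: eval_at_def subst_u_def fps_compose_add_distrib fps_compose_sub_distrib)

lemma eval_at_const: "eval_at w (fps_const x) = fls_const x"
proof (rule fls_eqI)
  fix n
  show "eval_at w (fps_const x) $$ n = fls_const x $$ n"
    using eval_at_nth[of n "nat n" "fps_const x"]
    by (cases "n < 0") (simp_all add: if_distrib[of "\<lambda>y. y * _"] cong: if_cong)
qed

lemma eval_at_X: "eval_at w fps_X = scal_fls (inverse w)"
proof (rule fls_eqI)
  fix n
  show "eval_at w fps_X $$ n = scal_fls (inverse w) $$ n"
    using eval_at_nth[of n "Suc (nat n)" fps_X] w
    by (cases "n < 1") (simp_all add: fps_X_def if_distrib[of "\<lambda>y. y * _"] cong: if_cong)
qed

lemma eval_at_mult: "eval_at w (f * h) = eval_at w f * eval_at w h"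
proof -
  define G where "G i n = scal ((inverse w ^ i) $$ int n)" for i n
  let ?g = "fls_regpart (scal_fls (inverse w))"
  have G: "(?g ^ i) $ n = G i n" for i n
    by (simp add: G_def regpart_inverse_power_nth)
  have G0: "G i n = 0" if "n < i" for i n
    using that by (simp add: G_def inverse_power_nth_0)
  have Gc: "G i n * x = x * G i n" for i n x
    unfolding G_def by (rule scal_central)
  have Gm: "(\<Sum>k=0..n. G i k * G j (n - k)) = G (i + j) n" for i j n
    by (simp add: power_add fps_mult_nth flip: G)
  have comp: "(F oo ?g) $ k = (\<Sum>i=0..n. F $ i * G i k)" if "k \<le> n" for F k n
    unfolding fps_compose_nth G using that by (intro sum.mono_neutral_left) (auto simp: G0)
  have "((f oo ?g) * (h oo ?g)) $ n = ((f * h) oo ?g) $ n" for n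
  proof -
    have "((f oo ?g) * (h oo ?g)) $ n =
      (\<Sum>k=0..n. \<Sum>i=0..n. \<Sum>j=0..n. f $ i * h $ j * (G i k * G j (n - k)))"
      unfolding fps_mult_nth
    proof (rule sum.cong)
      fix k assume "k \<in> {0..n}"
      then have "(f oo ?g) $ k * (h oo ?g) $ (n - k) =
        (\<Sum>i=0..n. f $ i * G i k) * (\<Sum>j=0..n. h $ j * G j (n - k))"
        by (simp only: comp[of k n] comp[of "n - k" n] atLeastAtMost_iff diff_le_self)
      also have "\<dots> = (\<Sum>i=0..n. \<Sum>j=0..n. f $ i * h $ j * (G i k * G j (n - k)))"
        unfolding sum_product
        by (intro sum.cong refl) (metis (no_types) Gc mult.assoc)
      finally show "(f oo ?g) $ k * (h oo ?g) $ (n - k) =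
        (\<Sum>i=0..n. \<Sum>j=0..n. f $ i * h $ j * (G i k * G j (n - k)))" .
    qed simp
    also have "\<dots> = (\<Sum>i=0..n. \<Sum>k=0..n. \<Sum>j=0..n. f $ i * h $ j * (G i k * G j (n - k)))"
      by (rule sum.swap)
    also have "\<dots> = (\<Sum>i=0..n. \<Sum>j=0..n. f $ i * h $ j * G (i + j) n)"
      unfolding Gm[symmetric] sum_distrib_left by (rule sum.cong, rule refl, rule sum.swap)
    also have "\<dots> = (\<Sum>(i, j)\<in>{0..n} \<times> {0..n}. f $ i * h $ j * G (i + j) n)"
      by (simp add: sum.cartesian_product)
    also have "\<dots> = (\<Sum>(i, j)\<in>{(i, j). i + j \<le> n}. f $ i * h $ j * G (i + j) n)"
      by (intro sum.mono_neutral_right) (auto, metis G0 mult_zero_right not_le)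
    also have "\<dots> = (\<Sum>m\<le>n. \<Sum>i\<le>m. f $ i * h $ (m - i) * G (i + (m - i)) n)"
      by (rule sum.triangle_reindex_eq)
    also have "\<dots> = ((f * h) oo ?g) $ n"
      unfolding fps_compose_nth G fps_mult_nth sum_distrib_right atMost_atLeast0
      by (intro sum.cong refl) auto
    finally show ?thesis .
  qed
  then show ?thesis
    unfolding eval_at_def subst_u_def by (simp add: fps_eq_iff flip: fls_times_fps_to_fls)
qed

lemma eval_at_eq_0: assumes "eval_at w f = 0" shows "f = 0"
proof (rule ccontr)
  assume "f \<noteq> 0"
  define n where "n = subdegree f"
  have "0 = (\<Sum>i\<le>n. f $ i * scal ((inverse w ^ i) $$ int n))"
    using eval_at_nth[of "int n" n f] assms by simp
  also have "\<dots> = (\<Sum>i\<in>{n}. f $ i * scal ((inverse w ^ i) $$ int n))"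
    unfolding n_def
    by (intro sum.mono_neutral_right ballI) (simp_all add: nth_less_subdegree_zero)
  finally have "scal ((inverse w ^ n) $$ int n) * f $ n = 0"
    by (simp add: scal_central)
  moreover have "(inverse w ^ n) $$ int n \<noteq> 0"
    using nth_fls_subdegree_nonzero[of "inverse w ^ n"] w w_nonzero by (simp add: fls_subdegree_pow)
  ultimately have "f $ n = 0" using scal_mult_cancel by blast
  then show False using \<open>f \<noteq> 0\<close> by (simp add: n_def)
qed

end

lemma eval_at_odd:
  assumes "\<And>n. even n \<Longrightarrow> f $ n = 0" and w: "fls_subdegree (inverse w) = 1"
  shows "eval_at (- w) f = - eval_at w f"
proof (rule fls_eqI)
  fix n
  have w': "fls_subdegree (inverse (- w)) = 1"
    using w by simp
  have "f $ i * scal ((inverse (- w) ^ i) $$ n) = - (f $ i * scal ((inverse w ^ i) $$ n))" for i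
    using assms(1)[of i] by (cases "even i") (simp_all add: scal_simps)
  then show "eval_at (- w) f $$ n = (- eval_at w f) $$ n"
    using eval_at_nth[OF w, of n "nat n" f] eval_at_nth[OF w', of n "nat n" f] by (simp add: sum_negf)
qed

section \<open>The generating series of the odd elements\<close>

lemma half: "scal (1/2) * x + scal (1/2) * x = x"
  by (simp flip: distrib_right scal_add)

lemma supercomm_even: "par a = a \<Longrightarrow> supercomm a x = a * x - x * a"
  by (simp add: supercomm_def even_part_def odd_part_def distrib_left half)

lemma par_diff: "par (x - y) = par x - par y"
  using par_add[of x "- y"] by (simp add: par_uminus)

lemma supercomm_odd:
  assumes "par a = - a" "par x = - x"
  shows "supercomm a x = a * x + x * a"
  by (simp add: supercomm_def even_part_def odd_part_def assms distrib_left half)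

lemma eta_0: "eta 0 = ogen"
  by (simp add: eta_def ogen_def)

lemma eta_Suc: "eta (Suc i) = scal (- 1/2) * (hgen * eta i - eta i * hgen)"
proof -
  have "par hgen = hgen" by (simp add: hgen_def par_tY)
  moreover have "supercomm hgen (scal c * x) = scal c * supercomm hgen x" if "par hgen = hgen" for c x
    unfolding supercomm_even[OF that] right_diff_distrib
    by (metis (no_types) mult.assoc scal_central)
  ultimately show ?thesis
    by (simp add: eta_def supercomm_even flip: hgen_def) (simp flip: scal_mult mult.assoc)
qed

lemma par_eta: "par (eta i) = - eta i"
proof (induction i)
  case 0
  then show ?case by (simp add: eta_0 ogen_def par_tY)
next
  case (Suc i)
  have "par hgen = hgen" by (simp add: hgen_def par_tY)
  with Suc show ?case
    by (simp add: eta_Suc par_mult par_diff) (simp add: algebra_simps)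
qed

lemma hgen_eta: "hgen * eta i - eta i * hgen = - (eta (Suc i) + eta (Suc i))"
proof -
  have "scal (- 1/2) = - scal (1/2)"
    using scal_simps(1)[of "1/2"] by simp
  then show ?thesis
    using half[of "hgen * eta i - eta i * hgen"] by (simp add: eta_Suc)
qed

definition eta_ser :: "yangian fps" where
  "eta_ser = Abs_fps (\<lambda>n. if n = 0 then 0 else eta (n - 1))"

text \<open>The recursion \<open>[h, \<eta>\<^sub>i] = - 2 \<eta>\<^sub>i\<^sub>+\<^sub>1\<close> for the generating series.\<close>

lemma eta_ser_eq:
  "fps_X * (fps_const hgen * eta_ser - eta_ser * fps_const hgen) + (eta_ser + eta_ser) =
   fps_X * fps_const (ogen + ogen)"
proof (rule fps_ext)
  fix n
  have "n = 0 \<or> n = 1 \<or> (\<exists>m. n = Suc (Suc m))" by (cases n; cases "n - 1") auto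
  then show "(fps_X * (fps_const hgen * eta_ser - eta_ser * fps_const hgen) + (eta_ser + eta_ser)) $ n =
      (fps_X * fps_const (ogen + ogen)) $ n"
    by (auto simp: eta_ser_def eta_0 hgen_eta)
qed

text \<open>This is \<open>\<Sum>\<^sub>i [\<eta>\<^sub>0, \<eta>\<^sub>i] w\<^bsup>-i-1\<^esup> / 2\<close>. The series \<open>H\<close> of the theorem
  keeps the odd powers only; the two agree by lemma \<open>H_full_eq_Hser\<close> below.\<close>

definition H_full :: "yangian fps" where
  "H_full = fps_const (scal (1/2)) * (fps_const ogen * eta_ser + eta_ser * fps_const ogen)"

lemma bracket_eval_eta:
  assumes w: "fls_subdegree (inverse w) = 1"
  shows "h_fls * eval_at w eta_ser - eval_at w eta_ser * h_fls = e_fls + e_fls - scal_fls (2 * w) * eval_at w eta_ser"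
proof -
  let ?E = "eval_at w eta_ser"
  have fc: "fls_const (x + x) = fls_const x + fls_const x" for x :: yangian
    by (simp add: fls_plus_const)
  have "scal_fls (inverse w) * (h_fls * ?E - ?E * h_fls) + (?E + ?E) = scal_fls (inverse w) * (e_fls + e_fls)"
    using arg_cong[OF eta_ser_eq, of "eval_at w"]
    by (simp only: eval_at_mult[OF w] eval_at_add[OF w] eval_at_diff[OF w]
        eval_at_const[OF w] eval_at_X[OF w] fc h_fls_def e_fls_def)
  from arg_cong[OF this, of "\<lambda>x. scal_fls w * x"]
  have "h_fls * ?E - ?E * h_fls + (scal_fls w + scal_fls w) * ?E = e_fls + e_fls"
    using w_nonzero[OF w]
    by (simp add: distrib_left distrib_right scal_fls_1 flip: mult.assoc scal_fls_mult)
  then show ?thesis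
    by (simp add: eq_diff_eq flip: scal_fls_add)
qed

lemma anticomm_eval_eta:
  assumes w: "fls_subdegree (inverse w) = 1"
  shows "e_fls * eval_at w eta_ser + eval_at w eta_ser * e_fls = eval_at w H_full + eval_at w H_full"
proof -
  let ?y = "fps_const ogen * eta_ser + eta_ser * fps_const ogen"
  have "H_full + H_full = ?y"
    by (simp add: H_full_def fps_eq_iff half)
  from arg_cong[OF this, of "eval_at w"] show ?thesis
    by (simp add: eval_at_mult[OF w] eval_at_add[OF w] eval_at_const[OF w] e_fls_def)
qed

section \<open>The two factors\<close>

interpretation q1_commuting fls_X_inv h_fls e_fls
  a_fls a_fls' b_fls b_fls' c_fls c_fls' d_fls d_fls'
  by (rule yangian_central)

text \<open>Both \<open>y = x + \<beta>x'\<close> and \<open>(1/2)(1 + \<beta>)(f + S) \<eta>(w)\<close>, where \<open>f = C - \<beta>D\<close>, solve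
  \<open>[h, y] = - 2wy + (1 + \<beta>)(f + S)e\<close>, which has only one solution because \<open>w\<close> has positive degree. The
  claim is the equality of their brackets with \<open>e\<close>, divided by \<open>1 + \<beta>\<close>.\<close>

lemma eigenvector:
  assumes root: "\<beta> ^ 2 = 4 * uvar * \<beta> + 1" and w_def: "2 * w = 1 + \<beta> - 2 * uvar"
    and w: "fls_subdegree (inverse w) = 1" and "\<beta> \<noteq> - 1"
  shows "(C - scal_fls \<beta> * D + S) * eval_at w H_full = C - scal_fls \<beta> * D - S"
proof -
  define B where "B = scal_fls \<beta>"
  define c where "c = scal_fls ((1 + \<beta>) / 2)"
  define P where "P = C - B * D"
  define y where "y = a_fls * d_fls + B * (a_fls' * d_fls')"
  define E where "E = eval_at w eta_ser"
  have B: "z * B = B * z" for z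
    unfolding B_def by (rule scal_fls_central[symmetric])
  have c: "z * c = c * z" for z
    unfolding c_def by (rule scal_fls_central[symmetric])
  have cc: "c + c = 1 + B"
  proof -
    have "x / 2 + x / 2 = x" for x :: "complex fls" by simp
    then show ?thesis
      unfolding c_def B_def scal_fls_add[symmetric] scal_fls_1[symmetric] by metis
  qed
  have BB: "B * B = 4 * fls_X_inv * B + 1"
    using arg_cong[OF root, of scal_fls]
    by (simp add: B_def power2_eq_square scal_fls_add scal_fls_mult scal_fls_numeral scal_fls_uvar scal_fls_1)
  have "2 * fls_X_inv - 1 - B = - scal_fls (2 * w)"
    unfolding w_def B_def by (simp add: scal_fls_add scal_fls_diff scal_fls_mult scal_fls_numeral scal_fls_uvar scal_fls_1)
  then have h_y: "h_fls * y - y * h_fls = - (scal_fls (2 * w) * y) + (1 + B) * (P + S) * e_fls"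
    using eigen_h[OF B BB] by (simp add: y_def P_def)
  have e_y: "e_fls * y + y * e_fls = (1 + B) * (P - S)"
    using eigen_e[OF B BB] by (simp add: y_def P_def)
  have "h_fls * P = P * h_fls"
    using h_commute commute_left[OF B[of h_fls]] unfolding P_def by (simp add: algebra_simps)
  then have PS: "h_fls * (P + S) = (P + S) * h_fls"
    using h_commute by (simp add: algebra_simps)
  have "e_fls * P = P * e_fls"
    using e_commute commute_left[OF B[of e_fls]] unfolding P_def by (simp add: algebra_simps)
  then have ePS: "e_fls * (P + S) = (P + S) * e_fls"
    using e_commute by (simp add: algebra_simps)
  have r: "h_fls * (c * ((P + S) * E)) = c * ((P + S) * (h_fls * E))"
    "e_fls * (c * ((P + S) * E)) = c * ((P + S) * (e_fls * E))"
    unfolding commute_left[OF c] commute_left[OF PS] commute_left[OF ePS] by (rule refl)+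
  define z where "z = y - c * ((P + S) * E)"
  have "h_fls * (c * ((P + S) * E)) - c * ((P + S) * E) * h_fls = c * ((P + S) * (h_fls * E - E * h_fls))"
    unfolding r by (simp add: algebra_simps)
  also have "\<dots> = c * ((P + S) * (e_fls + e_fls)) - c * ((P + S) * (scal_fls (2 * w) * E))"
    unfolding E_def bracket_eval_eta[OF w] by (simp only: right_diff_distrib)
  also have "c * ((P + S) * (e_fls + e_fls)) = (c + c) * (P + S) * e_fls"
    by (simp only: distrib_left distrib_right mult.assoc add_ac)
  also have "c * ((P + S) * (scal_fls (2 * w) * E)) = scal_fls (2 * w) * (c * ((P + S) * E))"
    by (simp only: commute_left[OF scal_fls_central])
  finally have "h_fls * z - z * h_fls = - (scal_fls (2 * w) * z)"
    using h_y unfolding z_def cc by (simp add: algebra_simps flip: mult_2)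
  then have "scal_fls (2 * w) * z = z * h_fls - h_fls * z" by (simp add: algebra_simps)
  then have "z = 0"
  proof (rule eq_0_if_degree_raised[rotated])
    have "fls_subdegree w = - 1" using w w_nonzero[OF w] by simp
    then show "fls_subdegree (2 * w) < 0" using w_nonzero[OF w] by simp
    show "\<forall>k<N. (z * h_fls - h_fls * z) $$ k = 0" if "\<forall>k<N. z $$ k = 0" for N
      using that by (simp add: h_fls_def)
  qed
  then have y: "y = c * ((P + S) * E)" by (simp add: z_def)
  have "(1 + B) * (P - S) = c * ((P + S) * (e_fls * E + E * e_fls))"
    unfolding e_y[symmetric] y r by (simp add: algebra_simps)
  also have "\<dots> = (c + c) * ((P + S) * eval_at w H_full)"
    unfolding E_def anticomm_eval_eta[OF w] by (simp only: distrib_left distrib_right mult.assoc add_ac)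
  finally have "scal_fls (1 + \<beta>) * ((P + S) * eval_at w H_full - (P - S)) = 0"
    unfolding cc by (simp add: B_def scal_fls_add scal_fls_1 right_diff_distrib)
  moreover have "1 + \<beta> \<noteq> 0" using assms(4) by (simp add: add_eq_0_iff)
  ultimately have "(P + S) * eval_at w H_full - (P - S) = 0" by (rule scal_fls_cancel[rotated])
  then show ?thesis by (simp add: P_def B_def)
qed

lemma C_eq: "C = fps_to_fls Cser" and D_eq: "D = fps_to_fls Dser"
  unfolding C_def D_def Cser_def Dser_def unfolding series_defs by (simp_all add: fls_times_fps_to_fls)

text \<open>The order 2 of \<open>D\<close> compensates the simple pole of \<open>\<beta>\<close> at infinity, so \<open>C - \<beta>D\<close> is a power series with
  constant term 1.\<close>

lemma D_lowest: "n < 2 \<Longrightarrow> D $$ n = 0"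
proof -
  assume "n < 2"
  have t: "tser 1 (- 1) $ 0 = 0" by (simp add: tser_def tY_0)
  have "(tser 1 (- 1) * neg_u (ttilde 1 1)) $ 0 = - (tser 1 1 * ttilde 1 (- 1)) $ 0"
    using inverse_relations(2) by (metis add.commute add_eq_0_iff fps_neg_nth)
  moreover have "tser 1 1 $ 0 = 1" by (simp add: tser_def tY_0)
  ultimately have d: "ttilde 1 (- 1) $ 0 = 0" by (simp add: t)
  have "n < 0 \<or> n = 0 \<or> n = 1" using \<open>n < 2\<close> by auto
  then show ?thesis
    by (auto simp: D_eq Dser_def fps_mult_nth t d)
qed

lemma ac_lowest: "tser 1 1 $ 0 = 1" "ttilde 1 1 $ 0 = 1"
proof -
  show a: "tser 1 1 $ 0 = 1" by (simp add: tser_def tY_0)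
  have t: "tser 1 (- 1) $ 0 = 0" by (simp add: tser_def tY_0)
  have "(tser 1 1 * ttilde 1 1 - tser 1 (- 1) * neg_u (ttilde 1 (- 1))) $ 0 = 1"
    by (simp only: inverse_relations(1)) simp
  then show "ttilde 1 1 $ 0 = 1" by (simp add: a t)
qed

lemma C_lowest: "n \<le> 0 \<Longrightarrow> C $$ n = (if n = 0 then 1 else 0)"
  by (simp add: C_eq Cser_def neg_u_def ac_lowest)

lemma S_lowest: "n \<le> 0 \<Longrightarrow> S $$ n = (if n = 0 then 1 else 0)"
  unfolding S_def unfolding series_defs
  by (simp add: neg_u_def ac_lowest flip: fls_times_fps_to_fls)

lemma C_minus_lowest:
  assumes "fls_subdegree \<beta> \<ge> - 1" "n \<le> 0"
  shows "(C - scal_fls \<beta> * D) $$ n = (if n = 0 then 1 else 0)"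
proof -
  have "(scal_fls \<beta> * D) $$ n = 0"
  proof (cases "D = 0")
    case False
    then have "fls_subdegree D \<ge> 2"
      using D_lowest by (intro fls_subdegree_geI) auto
    with assms show ?thesis
      by (intro fls_times_nth_eq0) (simp add: fls_subdegree_scal_fls)
  qed simp
  with C_lowest[OF assms(2)] show ?thesis by simp
qed

lemma unit_cancel:
  assumes f: "\<And>n. n < 0 \<Longrightarrow> f $$ n = 0" "f $$ 0 = scal c" "c \<noteq> 0" and 0: "f * x = 0"
  shows "x = 0"
proof (rule ccontr)
  assume x: "x \<noteq> 0"
  have "fls_subdegree f = 0"
    using f by (intro fls_subdegree_eqI) auto
  then have "scal c * x $$ fls_subdegree x = 0"
    using fls_times_base[of f x] f 0 by simp
  with f(3) have "x $$ fls_subdegree x = 0" by (rule scal_mult_cancel)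
  with x show False by simp
qed

lemma fls_subdegree_delta: "fls_subdegree delta = - 1"
proof -
  have "fls_subdegree (4 * uvar ^ 2 + 1) = - 2"
    by (subst fls_subdegree_add_eq1) simp_all
  moreover have "fls_subdegree (delta ^ 2) = 2 * fls_subdegree delta"
    by (simp add: fls_subdegree_pow)
  ultimately show ?thesis
    by (simp add: delta_square add.commute)
qed

lemma root_subdegree: "fls_subdegree (2 * uvar - delta) \<ge> - 1" "fls_subdegree (2 * uvar + delta) \<ge> - 1"
proof -
  have "(2 * uvar - delta) $$ n = 0" "(2 * uvar + delta) $$ n = 0" if "n < - 1" for n
    using that fls_subdegree_delta by simp_all
  then show "fls_subdegree (2 * uvar - delta) \<ge> - 1" "fls_subdegree (2 * uvar + delta) \<ge> - 1"
    by (cases "2 * uvar - delta = 0", simp_all, intro fls_subdegree_geI, simp_all)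
      (cases "2 * uvar + delta = 0", simp_all, intro fls_subdegree_geI, simp_all)
qed

text \<open>This allows the division by \<open>1 + \<beta>\<close>.\<close>

lemma not_minus_one: "2 * uvar - delta \<noteq> - 1" "2 * uvar + delta \<noteq> - 1"
proof -
  have "delta ^ 2 \<noteq> (2 * uvar + 1) ^ 2"
  proof -
    have "(2 * uvar + 1) ^ 2 = delta ^ 2 + 4 * uvar"
      by (simp add: delta_square) (simp add: power2_eq_square algebra_simps)
    then show ?thesis by simp
  qed
  moreover have "(- 1 - 2 * uvar) ^ 2 = (2 * uvar + 1) ^ 2"
    by (simp add: power2_eq_square algebra_simps)
  ultimately have d: "delta \<noteq> 2 * uvar + 1" "delta \<noteq> - 1 - 2 * uvar"
    by metis+
  have "delta = 2 * uvar + 1" if "2 * uvar - delta = - 1"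
    using arg_cong[OF that, of "\<lambda>x. 2 * uvar - x"] by simp
  with d show "2 * uvar - delta \<noteq> - 1" by blast
  have "delta = - 1 - 2 * uvar" if "2 * uvar + delta = - 1"
    using arg_cong[OF that, of "\<lambda>x. x - 2 * uvar"] by simp
  with d show "2 * uvar + delta \<noteq> - 1" by blast
qed

lemma rho_subdegree: "fls_subdegree (inverse (- rho)) = 1"
  using fls_subdegree_inverse_rho by simp

text \<open>The series \<open>f\<^sub>-\<close> and \<open>f\<^sub>+\<close> of the introduction. They turn out to be \<open>Q(\<rho> + 1)\<close> inverse and \<open>Q(\<rho>)\<close>.\<close>

definition factor_minus where "factor_minus = C - scal_fls (2 * uvar - delta) * D"
definition factor_plus where "factor_plus = C - scal_fls (2 * uvar + delta) * D"

lemma cayley: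
  fixes f s r :: "'a::ring_1"
  shows "(f + s) * (- r) = f - s \<Longrightarrow> s * (1 - r) = f * (1 + r)"
    and "(f + s) * r = f - s \<Longrightarrow> s * (1 + r) = f * (1 - r)"
  by (simp_all add: algebra_simps)

lemma two_rho: "2 * rho = delta - 1" by (simp add: rho_def)

lemma roots: "(2 * uvar - delta)\<^sup>2 = 4 * uvar * (2 * uvar - delta) + 1"
  "(2 * uvar + delta)\<^sup>2 = 4 * uvar * (2 * uvar + delta) + 1"
  using delta_square by (simp_all add: power2_eq_square algebra_simps)

lemma eigen_minus: "(factor_minus + S) * eval_at (- rho) H_full = factor_minus - S"
  unfolding factor_minus_def using not_minus_one(1) roots(1) two_rho by (intro eigenvector rho_subdegree) (simp_all)

lemma eigen_plus: "(factor_plus + S) * eval_at (rho + 1) H_full = factor_plus - S"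
  unfolding factor_plus_def using not_minus_one(2) roots(2) two_rho
  by (intro eigenvector fls_subdegree_inverse_rho(2)) (simp_all add: distrib_left)

lemma S_factors: "S = factor_minus * factor_plus" "S = factor_plus * factor_minus"
proof -
  have c: "z * scal_fls b = scal_fls b * z" for b z by (rule scal_fls_central[symmetric])
  have b: "scal_fls b * scal_fls b = 4 * fls_X_inv * scal_fls b + 1"
    "4 * fls_X_inv - scal_fls b = scal_fls (4 * uvar - b)" if "b\<^sup>2 = 4 * uvar * b + 1" for b
    using arg_cong[OF that, of scal_fls]
    by (simp_all add: power2_eq_square scal_fls_add scal_fls_diff scal_fls_mult scal_fls_numeral scal_fls_uvar scal_fls_1)
  have d: "4 * uvar - (2 * uvar - delta) = 2 * uvar + delta" "4 * uvar - (2 * uvar + delta) = 2 * uvar - delta"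
    by simp_all
  show "S = factor_minus * factor_plus"
    using factor_S[OF c b(1)] roots(1) b(2) d(1) unfolding factor_minus_def factor_plus_def by metis
  show "S = factor_plus * factor_minus"
    using factor_S[OF c b(1)] roots(2) b(2) d(2) unfolding factor_minus_def factor_plus_def by metis
qed

section \<open>Oddness of the series of central elements\<close>

text \<open>By lemma \<open>eigen_plus\<close>, \<open>H(\<rho> + 1)\<close> is a quotient of series commuting with \<open>h\<close>, and the substitution of
  \<open>\<rho> + 1\<close> is injective.\<close>

lemma hgen_H_full: "fps_const hgen * H_full = H_full * fps_const hgen"
proof -
  note w = fls_subdegree_inverse_rho(2)
  let ?h = "eval_at (rho + 1) H_full"
  have comm: "h_fls * factor_plus = factor_plus * h_fls"
    using h_commute commute_left[OF scal_fls_central[of _ h_fls, symmetric]] unfolding factor_plus_def by (simp add: algebra_simps)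
  have 1: "h_fls * ((factor_plus + S) * ?h) = (factor_plus + S) * ?h * h_fls"
    unfolding eigen_plus using comm h_commute(3) by (simp add: left_diff_distrib right_diff_distrib)
  have 2: "h_fls * (factor_plus + S) = (factor_plus + S) * h_fls"
    using comm h_commute(3) by (simp add: distrib_left distrib_right)
  have "(factor_plus + S) * (h_fls * ?h) = (factor_plus + S) * (?h * h_fls)"
    using 1 unfolding commute_left[OF 2] mult.assoc .
  then have 0: "(factor_plus + S) * (h_fls * ?h - ?h * h_fls) = 0"
    by (simp only: right_diff_distrib diff_self)
  have lowest: "(factor_plus + S) $$ n = (if n = 0 then scal 2 else 0)" if "n \<le> 0" for n
    using C_minus_lowest[OF root_subdegree(2) that] S_lowest[OF that] by (simp add: factor_plus_def scal_numeral)
  have "h_fls * ?h - ?h * h_fls = 0"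
    by (rule unit_cancel[OF _ _ _ 0, of 2]) (simp_all only: lowest order.refl less_imp_le, simp_all)
  then have "eval_at (rho + 1) (fps_const hgen * H_full - H_full * fps_const hgen) = 0"
    by (simp add: eval_at_diff[OF w] eval_at_mult[OF w] eval_at_const[OF w] h_fls_def)
  from eval_at_eq_0[OF w this] show ?thesis by simp
qed

definition eta_anticomm :: "nat \<Rightarrow> nat \<Rightarrow> yangian" where
  "eta_anticomm i j = eta i * eta j + eta j * eta i"

lemma H_full_nth: "H_full $ n = (if n = 0 then 0 else scal (1/2) * eta_anticomm 0 (n - 1))"
  by (simp add: H_full_def eta_ser_def eta_anticomm_def eta_0)

lemma scal_half_cancel: "scal (1/2) * x = scal (1/2) * y \<Longrightarrow> x = y"
  by (metis half)

lemma hgen_eta_anticomm_0: "hgen * eta_anticomm 0 i = eta_anticomm 0 i * hgen"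
proof -
  have "(fps_const hgen * H_full) $ Suc i = (H_full * fps_const hgen) $ Suc i"
    by (simp only: hgen_H_full)
  then have "scal (1/2) * (hgen * eta_anticomm 0 i) = scal (1/2) * (eta_anticomm 0 i * hgen)"
    by (simp add: H_full_nth commute_left[OF scal_central[symmetric]] mult.assoc)
  then show ?thesis by (rule scal_half_cancel)
qed

text \<open>The bracket with \<open>h\<close> kills \<open>[\<eta>\<^sub>i, \<eta>\<^sub>j]\<close>, and on the other hand it raises one of the
  indices. So one index can be traded for the other at the cost of a sign. Together with
  the symmetry in \<open>i\<close> and \<open>j\<close> this makes \<open>[\<eta>\<^sub>0, \<eta>\<^sub>n]\<close> vanish for odd \<open>n\<close>.\<close>

lemma eta_anticomm_shift: "eta_anticomm i j = (- 1) ^ i * eta_anticomm 0 (i + j)"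
proof (induction i arbitrary: j)
  case (Suc i)
  have "hgen * eta_anticomm i j = eta_anticomm i j * hgen"
    by (simp only: Suc[of j] sign_left_commute hgen_eta_anticomm_0 mult.assoc)
  moreover have "hgen * eta_anticomm i j - eta_anticomm i j * hgen =
      - (eta_anticomm (Suc i) j + eta_anticomm i (Suc j) + (eta_anticomm (Suc i) j + eta_anticomm i (Suc j)))"
  proof -
    have r: "hgen * eta k = eta k * hgen - eta (Suc k) - eta (Suc k)" for k
      using hgen_eta[of k] by (simp add: algebra_simps)
    have r': "hgen * (eta k * x) = eta k * (hgen * x) - eta (Suc k) * x - eta (Suc k) * x" for k x
      using arg_cong[OF r, of "\<lambda>y. y * x" k] by (simp add: left_diff_distrib mult.assoc)
    show ?thesis unfolding eta_anticomm_def by (simp add: r r' algebra_simps)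
  qed
  ultimately have "- (scal 2 * (eta_anticomm (Suc i) j + eta_anticomm i (Suc j))) = 0"
    by (simp only: scal_numeral mult_2) (simp only: diff_self)
  then have "scal 2 * (eta_anticomm (Suc i) j + eta_anticomm i (Suc j)) = 0" by simp
  then have "eta_anticomm (Suc i) j = - eta_anticomm i (Suc j)"
    using scal_mult_cancel[of 2] by (simp add: eq_neg_iff_add_eq_0)
  then show ?case using Suc[of "Suc j"] by simp
qed simp

lemma eta_anticomm_odd: "odd n \<Longrightarrow> eta_anticomm 0 n = 0"
proof -
  assume "odd n"
  have "eta_anticomm 0 n = eta_anticomm n 0" by (simp add: eta_anticomm_def add.commute)
  also have "\<dots> = - eta_anticomm 0 n" using eta_anticomm_shift[of n 0] \<open>odd n\<close> by simp
  finally have "scal 2 * eta_anticomm 0 n = 0" by (simp add: scal_numeral mult_2 eq_neg_iff_add_eq_0)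
  then show ?thesis using scal_mult_cancel[of 2] by simp
qed

lemma H_full_eq_Hser: "H_full = Hser"
proof (rule fps_ext)
  fix n
  show "H_full $ n = Hser $ n"
  proof (cases "odd n")
    case True
    then have n: "n \<noteq> 0" "2 * ((n - 1) div 2) = n - 1" by (auto elim: oddE)
    show ?thesis
      using True n supercomm_odd[OF par_eta par_eta, of 0 "n - 1"]
      by (simp add: H_full_nth Hser_def Z_even_def eta_anticomm_def)
  next
    case False
    then show ?thesis using eta_anticomm_odd[of "n - 1"] by (simp add: H_full_nth Hser_def)
  qed
qed

section \<open>The formulas\<close>

lemma Qser_eq: "Qser * (1 - Hser) = 1 + Hser"
  by (simp add: Qser_def mult.assoc one_minus_Hser_inverse)

lemma eval_at_one: "fls_subdegree (inverse w) = 1 \<Longrightarrow> eval_at w 1 = 1"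
  using eval_at_const[of w 1] by simp

lemma eval_at_Hser_cancel:
  assumes w: "fls_subdegree (inverse w) = 1" and "x * (1 - eval_at w Hser) = y * (1 - eval_at w Hser)"
  shows "x = y"
proof -
  have 1: "(1 - eval_at w Hser) * eval_at w (unit_inv (1 - Hser)) = 1"
    using arg_cong[OF one_minus_Hser_inverse(1), of "eval_at w"]
    by (simp add: eval_at_mult[OF w] eval_at_diff[OF w] eval_at_one[OF w])
  have "x = x * (1 - eval_at w Hser) * eval_at w (unit_inv (1 - Hser))" by (simp add: mult.assoc 1)
  also have "\<dots> = y" unfolding assms(2) by (simp add: mult.assoc 1)
  finally show ?thesis .
qed

lemma eval_at_Qser:
  assumes w: "fls_subdegree (inverse w) = 1"
  shows "eval_at w Qser * (1 - eval_at w Hser) = 1 + eval_at w Hser"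
  using arg_cong[OF Qser_eq, of "eval_at w"]
  by (simp add: eval_at_mult[OF w] eval_at_diff[OF w] eval_at_add[OF w] eval_at_one[OF w])

lemma factor_minus_cancel: "factor_minus * x = 0 \<Longrightarrow> x = 0"
  by (rule unit_cancel[of factor_minus 1]) (simp_all add: factor_minus_def C_minus_lowest[OF root_subdegree(1)] del: fls_minus_nth)

lemma factor_plus_cancel: "factor_plus * x = 0 \<Longrightarrow> x = 0"
  by (rule unit_cancel[of factor_plus 1]) (simp_all add: factor_plus_def C_minus_lowest[OF root_subdegree(2)] del: fls_minus_nth)

text \<open>Lemma \<open>eigen_minus\<close> determines \<open>H(-\<rho>)\<close>, which is \<open>-H(\<rho>)\<close>. Its Cayley transform is the equation
  \<open>S = f\<^sub>- Q(\<rho>)\<close>, from which the factor \<open>f\<^sub>-\<close> of \<open>S\<close> can be cancelled.\<close>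

lemma eval_at_Qser_rho: "eval_at rho Qser = factor_plus"
proof -
  let ?r = "eval_at rho Hser"
  note w = fls_subdegree_inverse_rho(1)
  have minus: "eval_at (- rho) Hser = - ?r"
    by (rule eval_at_odd[OF _ w]) (simp add: Hser_def)
  have "S * (1 - ?r) = factor_minus * (1 + ?r)"
    using eigen_minus unfolding H_full_eq_Hser minus by (rule cayley)
  then have "S * (1 - ?r) = factor_minus * eval_at rho Qser * (1 - ?r)"
    by (simp only: eval_at_Qser[OF w] mult.assoc)
  then have "S = factor_minus * eval_at rho Qser" by (rule eval_at_Hser_cancel[OF w])
  then have "factor_minus * (eval_at rho Qser - factor_plus) = 0" using S_factors(1) by (simp add: right_diff_distrib)
  from factor_minus_cancel[OF this] show ?thesis by simp
qed

lemma factor_minus_eval_Qser: "factor_minus * eval_at (rho + 1) Qser = 1"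
proof -
  let ?r = "eval_at (rho + 1) Hser"
  note w = fls_subdegree_inverse_rho(2)
  have "S * (1 + ?r) = factor_plus * (1 - ?r)"
    using eigen_plus unfolding H_full_eq_Hser by (rule cayley)
  then have "S * eval_at (rho + 1) Qser * (1 - ?r) = factor_plus * (1 - ?r)"
    by (simp only: eval_at_Qser[OF w] mult.assoc)
  then have "S * eval_at (rho + 1) Qser = factor_plus" by (rule eval_at_Hser_cancel[OF w])
  then have "factor_plus * (factor_minus * eval_at (rho + 1) Qser - 1) = 0"
    using S_factors(2) by (simp add: right_diff_distrib mult.assoc)
  from factor_plus_cancel[OF this] show ?thesis by simp
qed

lemma inverse_Qser: "fps_to_fls (unit_inv (subst_u Qser (rho + 1))) = factor_minus"
proof -
  let ?f = "subst_u Qser (rho + 1)"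
  have "fps_to_fls ?f * fps_to_fls (unit_inv ?f) = 1"
    by (simp add: unit_inv(1)[OF subst_Qser_nth_0] flip: fls_times_fps_to_fls)
  then have "factor_minus * fps_to_fls ?f * fps_to_fls (unit_inv ?f) = factor_minus"
    by (simp only: mult.assoc mult_1_right)
  then show ?thesis using factor_minus_eval_Qser by (simp add: eval_at_def)
qed

theorem corollary3p5:
  "fps_to_fls Cser =
      scal_fls ((delta - 2 * uvar) / (2 * delta)) * fps_to_fls (subst_u Qser rho)
      + scal_fls ((delta + 2 * uvar) / (2 * delta)) * fps_to_fls (unit_inv (subst_u Qser (rho + 1)))
   \<and> fps_to_fls Dser =
      scal_fls (1 / (2 * delta)) *
        fps_to_fls (unit_inv (subst_u Qser (rho + 1)) - subst_u Qser rho)"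
proof
  have d: "delta \<noteq> 0" using fls_subdegree_delta by auto
  let ?s = scal_fls
  note Q = eval_at_Qser_rho[unfolded eval_at_def]
  \<comment> \<open>The combinations are chosen so that \<open>D\<close> cancels in the first formula and \<open>C\<close> in the second.\<close>
  have c: "(delta - 2 * uvar) / (2 * delta) + (delta + 2 * uvar) / (2 * delta) = 1"
    "(delta - 2 * uvar) / (2 * delta) * (2 * uvar + delta) + (delta + 2 * uvar) / (2 * delta) * (2 * uvar - delta) = 0"
    "1 / (2 * delta) * ((2 * uvar + delta) - (2 * uvar - delta)) = 1"
    using d by (simp_all add: field_simps)
  have "?s x * (C - ?s m * D) + ?s y * (C - ?s n * D) = ?s (x + y) * C - ?s (x * m + y * n) * D"
    for x y m n
    by (simp add: scal_fls_add scal_fls_mult right_diff_distrib distrib_right mult.assoc)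
  note combine = this[where m = "2 * uvar + delta" and n = "2 * uvar - delta", folded factor_minus_def factor_plus_def]
  from combine[of "(delta - 2 * uvar) / (2 * delta)" "(delta + 2 * uvar) / (2 * delta)"]
  show "fps_to_fls Cser = ?s ((delta - 2 * uvar) / (2 * delta)) * fps_to_fls (subst_u Qser rho)
      + ?s ((delta + 2 * uvar) / (2 * delta)) * fps_to_fls (unit_inv (subst_u Qser (rho + 1)))"
    by (simp only: Q inverse_Qser c scal_fls_0 scal_fls_1 C_eq) simp
  have "(C - ?s m * D) - (C - ?s n * D) = ?s (n - m) * D" for m n
    by (simp add: scal_fls_diff left_diff_distrib)
  from this[of "2 * uvar - delta" "2 * uvar + delta", folded factor_minus_def factor_plus_def]
  have "factor_minus - factor_plus = ?s ((2 * uvar + delta) - (2 * uvar - delta)) * D" .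
  then show "fps_to_fls Dser = ?s (1 / (2 * delta)) *
        fps_to_fls (unit_inv (subst_u Qser (rho + 1)) - subst_u Qser rho)"
    by (simp only: fps_to_fls_minus Q inverse_Qser mult.assoc[symmetric] scal_fls_mult[symmetric] c)
      (simp add: D_eq scal_fls_1)
qed

end
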